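(* Let $r\ge 1$ be a fixed integer and let $\boldsymbol{\mu}=(\mu_1,\ldots,\mu_r)$ be a probability distribution with $\mu_i>0$ for $i=1,\ldots,r$ (not depending on $n$). Let $K_1,\ldots,K_r,P:\mathbb{N}_0\to\mathbb{N}_0^{r+1}$ be a scaling such that $$\lambda_1(n)\sim c\,\frac{\log n}{n}$$ for some $c>0$. Under the assumptions $$P_n=\Omega(n)\qquad\text{and}\qquad \frac{(K_{1,n})^2}{P_n}=\omega\left(\frac1n\right),$$ we have $$\lim_{n\to\infty}\mathbb{P}\left[\mathbb{G}(n;\boldsymbol{\mu},\boldsymbol{K}_n,P_n)\text{ is connected}\right]=\begin{cases}0 & \text{if } c<1,\\ 1 & \text{if } c>1.\end{cases}$$
   Context: A scaling is a mapping $K_1,\ldots,K_r,P:\mathbb{N}_0\to\mathbb{N}_0^{r+1}$ (with values written $K_{1,n},\ldots,K_{r,n},P_n$) such that $1\le K_{1,n}\le K_{2,n}\le\cdots\le K_{r,n}<P_n$ for all $n=2,3,\ldots$. Write $\boldsymbol{K}_n=(K_{1,n},\ldots,K_{r,n})$. Inhomogeneous random key graph $\mathbb{G}(n;\boldsymbol{\mu},\boldsymbol{K},P)$: the vertex set is $\{v_1,\ldots,v_n\}$. Each node is independently assigned a class in $\{1,\ldots,r\}$, being of class $i$ with probability $\mu_i$. A class-$i$ node $v_x$ is given a key ring $\Sigma_x$ which is a uniformly random subset of $\{1,\ldots,P\}$ of size $K_i$; the random sets $\Sigma_1,\ldots,\Sigma_n$ are independent and identically distributed. Two distinct nodes $v_x,v_y$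 are adjacent if and only if $\Sigma_x\cap\Sigma_y\ne\emptyset$. Define, for $i,j=1,\ldots,r$, $$p_{ij}(n)=1-\frac{\binom{P_n-K_{i,n}}{K_{j,n}}}{\binom{P_n}{K_{j,n}}},\qquad \lambda_i(n)=\sum_{j=1}^r p_{ij}(n)\mu_j,$$ where $\binom{a}{b}=0$ if $a<b$. All asymptotic statements are for $n\to\infty$; $a_n\sim b_n$ means $\lim a_n/b_n=1$; $P_n=\Omega(n)$ means there is $\sigma>0$ with $P_n\ge\sigma n$ for all $n$ sufficiently large; $a_n=\omega(b_n)$ means $a_n/b_n\to\infty$. *)

theory Defs
  imports
    "HOL-Probability.Probability"
    "HOL-Library.Landau_Symbols"
    "Graph_Theory.Graph_Theory"
begin

text \<open>
  \<open>K i n\<close> and \<open>P n\<close> stand for $K_{i,n}$ and $P_n$; the classes are \<open>1, \<dots>, r\<close>.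
\<close>

definition scaling :: "nat \<Rightarrow> (nat \<Rightarrow> nat \<Rightarrow> nat) \<Rightarrow> (nat \<Rightarrow> nat) \<Rightarrow> bool" where
  "scaling r K P \<longleftrightarrow>
     (\<forall>n\<ge>2. 1 \<le> K 1 n \<and> (\<forall>i\<in>{1..<r}. K i n \<le> K (Suc i) n) \<and> K r n < P n)"

text \<open>
  The law of a single key ring: a class \<open>i\<close> is drawn from \<open>\<mu>\<close>, then a uniform subset of the
  key pool \<open>{1..P}\<close> of size \<open>K i\<close>.  This is meaningful only if \<open>K i \<le> P\<close> for every class
  (otherwise \<^const>\<open>pmf_of_set\<close> is applied to the empty set), which a scaling ensures
  from \<open>n = 2\<close> on.
\<close>

definition key_ring_pmf :: "nat pmf \<Rightarrow> (nat \<Rightarrow> nat) \<Rightarrow> nat \<Rightarrow> nat set pmf" where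
  "key_ring_pmf \<mu> K P =
     bind_pmf \<mu> (\<lambda>i. pmf_of_set {S. S \<subseteq> {1..P} \<and> card S = K i})"

text \<open>An undirected simple graph is represented by a loop-free symmetric digraph.\<close>

definition key_graph :: "nat \<Rightarrow> (nat \<Rightarrow> nat set) \<Rightarrow> nat pair_pre_digraph" where
  "key_graph n \<Sigma> =
     \<lparr> pverts = {1..n},
       parcs = {(x, y). x \<in> {1..n} \<and> y \<in> {1..n} \<and> x \<noteq> y \<and> \<Sigma> x \<inter> \<Sigma> y \<noteq> {}} \<rparr>"

lemma pair_graph_key_graph: "pair_graph (key_graph n \<Sigma>)"
proof
  show "finite (parcs (key_graph n \<Sigma>))"
    by (rule finite_subset[of _ "{1..n} \<times> {1..n}"]) (auto simp: key_graph_def)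
  show "symmetric (with_proj (key_graph n \<Sigma>))"
    by (auto simp: symmetric_def sym_def key_graph_def arcs_ends_def arc_to_ends_def)
qed (auto simp: key_graph_def)

definition random_key_graph ::
    "nat \<Rightarrow> nat pmf \<Rightarrow> (nat \<Rightarrow> nat) \<Rightarrow> nat \<Rightarrow> nat pair_pre_digraph pmf" where
  "random_key_graph n \<mu> K P =
     map_pmf (key_graph n) (Pi_pmf {1..n} {} (\<lambda>_. key_ring_pmf \<mu> K P))"

definition edge_prob ::
    "(nat \<Rightarrow> nat \<Rightarrow> nat) \<Rightarrow> (nat \<Rightarrow> nat) \<Rightarrow> nat \<Rightarrow> nat \<Rightarrow> nat \<Rightarrow> real" where
  "edge_prob K P i j n =
     1 - real ((P n - K i n) choose K j n) / real (P n choose K j n)"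

definition mean_edge_prob ::
    "nat \<Rightarrow> nat pmf \<Rightarrow> (nat \<Rightarrow> nat \<Rightarrow> nat) \<Rightarrow> (nat \<Rightarrow> nat) \<Rightarrow> nat \<Rightarrow> nat \<Rightarrow> real" where
  "mean_edge_prob r \<mu> K P i n = (\<Sum>j=1..r. edge_prob K P i j n * pmf \<mu> j)"

end

theory Submission
  imports Defs "HOL-Real_Asymp.Real_Asymp"
begin

text \<open>
  Both halves rest on one computation: given the key rings of the vertices in a block \<open>S\<close>, the
  remaining vertices are independent of them, so the probability that no edge leaves \<open>S\<close> is the
  probability that a single random ring avoids the union \<open>U\<close> of the rings in \<open>S\<close>, raised to the
  number of vertices outside \<open>S\<close> (\<open>prob_isolated_block\<close>).

  \<^item> Below the threshold, count the isolated vertices whose ring has the smallest size \<open>K\<^sub>1\<close>.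
    Each of the \<open>n\<close> vertices contributes a probability of order \<open>(1 - \<lambda>\<^sub>1)\<^bsup>n-1\<^esup> = n\<^bsup>-c+o(1)\<^esup>\<close>, so
    the expected count tends to infinity. Two such vertices have disjoint rings, so a third ring has
    to avoid \<open>2 K\<^sub>1\<close> keys. In each class this is at most the square of the probability of avoiding \<open>K\<^sub>1\<close> keys
    (\<open>choose_log_concave\<close>), and averaging over the classes costs only a variance of order
    \<open>\<lambda>\<^sub>1\<^sup>2 = o(1/n)\<close>. Hence the count is concentrated around its mean (\<open>prob_connected_le\<close>).

  \<^item> Above the threshold, a disconnected graph has a block \<open>S\<close> of \<open>l \<le> n/2\<close> vertices that no edge
    leaves, and a union bound over all blocks suffices, without asking \<open>S\<close> to be a component.
    The cost of a block splits in two. Either \<open>U\<close> is smaller than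
    \<open>u = min ((1 - \<delta>) l K\<^sub>1) (\<eta> P)\<close>, which forces at least a fraction \<open>\<delta>\<close> of the \<open>l K\<^sub>1\<close> drawn
    keys to be repetitions. Since \<open>K\<^sub>1\<close> tends to infinity (this is what the two growth conditions provide
    together), this is so unlikely that even after multiplication with
    \<open>n choose l\<close> a bound \<open>exp (1 - K\<^sub>1)\<^bsup>l\<^esup>\<close> remains (\<open>overlap_term_le\<close>). Or \<open>U\<close> has at least \<open>u\<close>
    elements, and then every vertex outside \<open>S\<close> avoids it with probability at most
    \<open>\<Sum>\<^sub>j \<mu>\<^sub>j exp (- u K\<^sub>j / P)\<close>. For \<open>l\<close> up to order \<open>n / log n\<close> this gives essentially
    \<open>n\<^bsup>-c l\<^esup>\<close> against at most \<open>n\<^bsup>l\<^esup>\<close> choices of the block; for larger \<open>l\<close> it gives a bound that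
    is exponentially small in \<open>n\<close> (\<open>separation_term_le\<close>). Geometric series in \<open>l\<close> then show that
    all these contributions vanish (\<open>prob_connected_ge\<close>).
\<close>

section \<open>Binomial estimates\<close>

lemma Suc_times_choose_Suc: "Suc k * (a choose Suc k) = (a - k) * (a choose k)"
  by (metis binomial_absorb_comp binomial_absorption mult.commute)

lemma choose_mult_power_le:
  assumes "a \<le> b"
  shows "(a choose k) * b ^ k \<le> a ^ k * (b choose k)"
proof (induction k)
  case (Suc k)
  have *: "(a - k) * b \<le> a * (b - k)"
    using assms by (simp add: diff_mult_distrib diff_mult_distrib2 mult.commute diff_le_mono2)
  have "Suc k * ((a choose Suc k) * b ^ Suc k) = ((a - k) * b) * ((a choose k) * b ^ k)"
    by (simp only: Suc_times_choose_Suc mult.assoc[symmetric] power_Suc) (simp only: ac_simps)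
  also have "\<dots> \<le> (a * (b - k)) * (a ^ k * (b choose k))"
    by (rule mult_le_mono[OF * Suc.IH])
  also have "\<dots> = a ^ Suc k * ((b - k) * (b choose k))"
    by (simp only: power_Suc ac_simps)
  also have "\<dots> = Suc k * (a ^ Suc k * (b choose Suc k))"
    by (simp only: mult.left_commute[of "a ^ Suc k"] Suc_times_choose_Suc[symmetric])
  finally show ?case
    by (subst (asm) mult_le_cancel1) auto
qed simp

lemma choose_ratio_le_power:
  assumes "a \<le> b" "k \<le> b" "0 < b"
  shows "real (a choose k) / real (b choose k) \<le> (real a / real b) ^ k"
proof -
  have "real ((a choose k) * b ^ k) \<le> real (a ^ k * (b choose k))"
    using choose_mult_power_le[OF assms(1)] by (simp only: of_nat_le_iff)
  thus ?thesis using assms by (simp add: field_simps power_divide)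
qed

text \<open>
  Avoiding \<open>2 m\<close> keys is at most as likely as twice, independently, avoiding \<open>m\<close> keys. Written as a product over
  the \<open>k\<close> draws, this holds factor by factor because
  \<open>(b - 2 m - i) (b - i) \<le> (b - m - i)\<^sup>2\<close>.
\<close>

lemma choose_log_concave:
  "(b - 2 * m choose k) * (b choose k) \<le> (b - m choose k)\<^sup>2"
proof (induction k)
  case (Suc k)
  have *: "(b - 2 * m - k) * (b - k) \<le> (b - m - k)\<^sup>2"
  proof (cases "2 * m + k \<le> b")
    case True
    then obtain d where "b = 2 * m + k + d" by (auto simp: le_iff_add)
    thus ?thesis by (simp add: power2_eq_square algebra_simps)
  qed simp
  have "(Suc k)\<^sup>2 * ((b - 2 * m choose Suc k) * (b choose Suc k))
      = (Suc k * (b - 2 * m choose Suc k)) * (Suc k * (b choose Suc k))"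
    by (simp only: power2_eq_square ac_simps)
  also have "\<dots> = ((b - 2 * m - k) * (b - k)) * ((b - 2 * m choose k) * (b choose k))"
    by (simp only: Suc_times_choose_Suc ac_simps)
  also have "\<dots> \<le> (b - m - k)\<^sup>2 * (b - m choose k)\<^sup>2"
    by (rule mult_le_mono[OF * Suc.IH])
  also have "\<dots> = (Suc k * (b - m choose Suc k))\<^sup>2"
    by (simp only: Suc_times_choose_Suc power_mult_distrib)
  also have "\<dots> = (Suc k)\<^sup>2 * (b - m choose Suc k)\<^sup>2"
    by (simp only: power_mult_distrib)
  finally show ?case by (subst (asm) mult_le_cancel1) auto
qed simp

text \<open>
  The union bound over the \<open>m\<close> forbidden elements: each of them lies in a random \<open>k\<close>-subset with
  probability \<open>k / b\<close>.
\<close>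

lemma choose_diff_ge:
  assumes "m \<le> b" "k \<le> b" "0 < b"
  shows "1 - real m * real k / real b \<le> real (b - m choose k) / real (b choose k)"
proof (cases "k = 0")
  case False
  have rec: "(b choose k) \<le> (b - m choose k) + m * (b - 1 choose (k - 1))"
    using assms(1)
  proof (induction m)
    case (Suc m)
    have "b - m = Suc (b - Suc m)" using Suc.prems by simp
    hence "(b - m choose k) = (b - Suc m choose k) + (b - Suc m choose (k - 1))"
      using False by (cases k) simp_all
    moreover have "(b - Suc m choose (k - 1)) \<le> (b - 1 choose (k - 1))"
      by (intro binomial_right_mono) simp
    ultimately show ?case using Suc by simp
  qed simp
  have "k * (b choose k) = b * (b - 1 choose (k - 1))"
    using False by (intro times_binomial_minus1_eq) simp
  hence "real (b - 1 choose (k - 1)) = real k * real (b choose k) / real b"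
    using assms by (simp add: field_simps flip: of_nat_mult)
  moreover have "real (b choose k) \<le> real (b - m choose k) + real m * real (b - 1 choose (k - 1))"
    using rec by (simp only: of_nat_le_iff flip: of_nat_mult of_nat_add)
  ultimately have "real (b choose k) - real (b - m choose k) \<le> real m * real k / real b * real (b choose k)"
    by simp
  hence "(real (b choose k) - real (b - m choose k)) / real (b choose k) \<le> real m * real k / real b"
    using assms by (subst pos_divide_le_eq) auto
  thus ?thesis using assms by (simp add: diff_divide_distrib)
qed (use assms in simp)

text \<open>
  The familiar estimate \<open>b choose m \<le> (e b / m)\<^bsup>m\<^esup>\<close>, in a form that needs no division by \<open>m\<close>.
  It serves twice: for choosing a set of keys and for choosing a set of vertices.
\<close>

lemma choose_mult_pow_le_exp:
  "real (b choose m) * (real m / real b) ^ m \<le> exp (real m)"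
proof (cases "b = 0")
  case False
  have "(\<Sum>i\<in>{m}. real m ^ i /\<^sub>R fact i) \<le> exp (real m)"
    unfolding exp_def by (rule sum_le_suminf) (use summable_exp_generic[of "real m"] in auto)
  hence 1: "real m ^ m / fact m \<le> exp (real m)" by (simp add: field_simps)
  have "real ((b choose m) * fact m) \<le> real (b ^ m)"
    using binomial_fact_pow[of b m] by (simp only: of_nat_le_iff)
  hence "real (b choose m) * fact m \<le> real b ^ m" by simp
  hence "real (b choose m) \<le> real b ^ m / fact m" by (simp add: field_simps)
  hence "real (b choose m) * (real m / real b) ^ m \<le> real b ^ m / fact m * (real m / real b) ^ m"
    by (intro mult_right_mono) auto
  also have "\<dots> = real m ^ m / fact m" using False by (simp add: power_divide)
  finally show ?thesis using 1 by linarith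
qed (cases m, simp_all)


lemma choose_diff_ratio_le_exp:
  assumes "m \<le> b" "k \<le> b" "0 < b"
  shows "real (b - m choose k) / real (b choose k) \<le> exp (- (real m / real b * real k))"
proof -
  have "real (b - m choose k) / real (b choose k) \<le> (real (b - m) / real b) ^ k"
    using assms by (intro choose_ratio_le_power) auto
  also have "\<dots> \<le> exp (- (real m / real b)) ^ k"
  proof (rule power_mono)
    have "real (b - m) / real b = 1 + (- (real m / real b))"
      using assms by (simp add: of_nat_diff field_simps)
    also have "\<dots> \<le> exp (- (real m / real b))" by (rule exp_ge_add_one_self)
    finally show "real (b - m) / real b \<le> exp (- (real m / real b))" .
  qed auto
  also have "\<dots> = exp (- (real m / real b * real k))"
    by (simp add: mult.commute flip: exp_of_nat_mult)
  finally show ?thesis .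
qed

lemma choose_diff_ratio_le_1:
  assumes "k \<le> b"
  shows "real (b - m choose k) / real (b choose k) \<le> 1"
proof -
  have "real (b - m choose k) \<le> real (b choose k)"
    by (intro of_nat_mono binomial_right_mono) auto
  moreover have "0 < real (b choose k)" using assms by simp
  ultimately show ?thesis by (subst divide_le_eq_1_pos)
qed

section \<open>Independent random blocks\<close>

lemma integrable_indicator_pmf: "integrable (measure_pmf M) (indicator A :: 'a \<Rightarrow> real)"
  by (rule measure_pmf.integrable_const_bound[where B = 1]) (auto simp: indicator_def)

lemma prob_bind_pmf:
  "measure_pmf.prob (bind_pmf M N) A = measure_pmf.expectation M (\<lambda>x. measure_pmf.prob (N x) A)"
proof -
  have int: "integrable (measure_pmf M) (\<lambda>x. measure_pmf.prob (N x) A)"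
    by (rule measure_pmf.integrable_const_bound[where B = 1]) auto
  have "ennreal (measure_pmf.prob (bind_pmf M N) A)
      = (\<integral>\<^sup>+x. ennreal (measure_pmf.prob (N x) A) \<partial>measure_pmf M)"
    by (simp flip: measure_pmf.emeasure_eq_measure)
  also have "\<dots> = ennreal (measure_pmf.expectation M (\<lambda>x. measure_pmf.prob (N x) A))"
    using int by (intro nn_integral_eq_integral) auto
  finally show ?thesis by (subst (asm) ennreal_inj) (auto intro!: integral_nonneg_AE)
qed

lemma prob_pair_pmf:
  "measure_pmf.prob (pair_pmf M N) A
     = measure_pmf.expectation M (\<lambda>x. measure_pmf.prob N {y. (x, y) \<in> A})"
proof -
  have "pair_pmf M N = bind_pmf M (\<lambda>x. map_pmf (Pair x) N)"
    by (simp add: pair_pmf_def map_pmf_def)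
  thus ?thesis by (simp add: prob_bind_pmf vimage_def)
qed

lemma expectation_pmf_cong:
  fixes f g :: "'a \<Rightarrow> real"
  assumes "\<And>x. x \<in> set_pmf M \<Longrightarrow> f x = g x"
  shows "measure_pmf.expectation M f = measure_pmf.expectation M g"
  by (rule integral_cong_AE) (auto simp: AE_measure_pmf_iff assms)

lemma set_Pi_pmf_component:
  "finite V \<Longrightarrow> f \<in> set_pmf (Pi_pmf V d p) \<Longrightarrow> x \<in> V \<Longrightarrow> f x \<in> set_pmf (p x)"
  by (auto simp: set_Pi_pmf PiE_dflt_def)

section \<open>A single key ring\<close>

locale key_rings =
  fixes r :: nat and \<mu> :: "nat pmf" and k :: "nat \<Rightarrow> nat" and P :: nat
  assumes r_pos: "1 \<le> r"
    and support: "set_pmf \<mu> \<subseteq> {1..r}"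
    and class_pos: "i \<in> {1..r} \<Longrightarrow> 0 < pmf \<mu> i"
    and size_pos: "1 \<le> k 1"
    and size_min: "i \<in> {1..r} \<Longrightarrow> k 1 \<le> k i"
    and size_max: "i \<in> {1..r} \<Longrightarrow> k i \<le> k r"
    and size_less_pool: "k r < P"
begin

abbreviation ring :: "nat set pmf" where
  "ring \<equiv> key_ring_pmf \<mu> k P"

text \<open>
  The probability that a random ring misses a fixed set of \<open>w\<close> keys; see \<open>prob_ring_avoid\<close>.
  By symmetry it depends on the set only through its size.
\<close>

definition avoid :: "nat \<Rightarrow> real" where
  "avoid w = (\<Sum>j=1..r. pmf \<mu> j * (real (P - w choose k j) / real (P choose k j)))"

text \<open>
  The Laplace transform of the random ring size. It dominates \<open>avoid w\<close> at \<open>t = w / P\<close> and, being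
  defined for real arguments, is more convenient for estimates.
\<close>

definition laplace :: "real \<Rightarrow> real" where
  "laplace t = (\<Sum>j=1..r. pmf \<mu> j * exp (- (t * real (k j))))"

lemma pool_pos: "0 < P"
  using size_less_pool by simp

lemma size_le_pool: "j \<in> {1..r} \<Longrightarrow> k j \<le> P"
  using size_max[of j] size_less_pool by simp

lemma sum_class: "(\<Sum>j=1..r. pmf \<mu> j) = 1"
  by (rule sum_pmf_eq_1) (use support in auto)

lemma uniform_nonempty: "k j \<le> P \<Longrightarrow> {S. S \<subseteq> {1..P} \<and> card S = k j} \<noteq> {}"
  using obtain_subset_with_card_n[of "k j" "{1..P}"] by auto

lemma uniform_finite: "finite {S. S \<subseteq> {1..P} \<and> card S = m}"
  by (rule finite_subset[of _ "Pow {1..P}"]) auto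

text \<open>
  Conditioning on the class reduces every event for a ring to counting subsets of the pool.
\<close>

lemma prob_ring:
  "measure_pmf.prob ring A
     = (\<Sum>j=1..r. pmf \<mu> j * (real (card {S. S \<subseteq> {1..P} \<and> card S = k j \<and> S \<in> A}) / real (P choose k j)))"
proof -
  have "measure_pmf.prob ring A
      = (\<Sum>j=1..r. measure_pmf.prob (pmf_of_set {S. S \<subseteq> {1..P} \<and> card S = k j}) A * pmf \<mu> j)"
    unfolding key_ring_pmf_def prob_bind_pmf
    by (rule integral_measure_pmf_real) (use support in auto)
  also have "\<dots> = (\<Sum>j=1..r. pmf \<mu> j *
      (real (card {S. S \<subseteq> {1..P} \<and> card S = k j \<and> S \<in> A}) / real (P choose k j)))"
  proof (rule sum.cong[OF refl])
    fix j assume "j \<in> {1..r}"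
    have "{S. S \<subseteq> {1..P} \<and> card S = k j} \<inter> A = {S. S \<subseteq> {1..P} \<and> card S = k j \<and> S \<in> A}"
      by auto
    thus "measure_pmf.prob (pmf_of_set {S. S \<subseteq> {1..P} \<and> card S = k j}) A * pmf \<mu> j = pmf \<mu> j *
      (real (card {S. S \<subseteq> {1..P} \<and> card S = k j \<and> S \<in> A}) / real (P choose k j))"
      using uniform_nonempty[OF size_le_pool[OF \<open>j \<in> {1..r}\<close>]] uniform_finite[of "k j"]
      by (simp add: measure_pmf_of_set n_subsets)
  qed
  finally show ?thesis .
qed

lemma ring_subset_pool: "T \<in> set_pmf ring \<Longrightarrow> T \<subseteq> {1..P}"
proof -
  assume "T \<in> set_pmf ring"
  then obtain j where j: "j \<in> set_pmf \<mu>" "T \<in> set_pmf (pmf_of_set {S. S \<subseteq> {1..P} \<and> card S = k j})"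
    by (auto simp: key_ring_pmf_def)
  have "j \<in> {1..r}" using j(1) support by auto
  thus ?thesis
    using j(2) set_pmf_of_set[OF uniform_nonempty[OF size_le_pool] uniform_finite] by blast
qed

lemma rings_subset_pool:
  assumes "finite S" "f \<in> set_pmf (Pi_pmf S {} (\<lambda>_. ring))"
  shows "(\<Union>x\<in>S. f x) \<subseteq> {1..P}"
proof (rule UN_least)
  fix x assume "x \<in> S"
  from set_Pi_pmf_component[OF assms this] show "f x \<subseteq> {1..P}" by (rule ring_subset_pool)
qed

lemma prob_ring_avoid:
  assumes "W \<subseteq> {1..P}"
  shows "measure_pmf.prob ring {T. T \<inter> W = {}} = avoid (card W)"
proof -
  have "card {S. S \<subseteq> {1..P} \<and> card S = m \<and> S \<in> {T. T \<inter> W = {}}} = (P - card W choose m)" for m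
  proof -
    have "{S. S \<subseteq> {1..P} \<and> card S = m \<and> S \<in> {T. T \<inter> W = {}}} = {S. S \<subseteq> {1..P} - W \<and> card S = m}"
      by auto
    thus ?thesis using assms finite_subset[OF assms]
      by (simp add: n_subsets card_Diff_subset)
  qed
  thus ?thesis by (simp add: prob_ring avoid_def)
qed

text \<open>
  Replacing every ring size by the smallest one only increases the probability that the ring
  fits into \<open>W\<close>, because \<open>card W / P \<le> 1\<close>.
\<close>

lemma prob_ring_subset_le:
  assumes "W \<subseteq> {1..P}"
  shows "measure_pmf.prob ring {T. T \<subseteq> W} \<le> (real (card W) / real P) ^ k 1"
proof -
  have card_W: "card W \<le> P" using card_mono[OF _ assms] by simp
  have fin: "finite W" by (rule finite_subset[OF assms]) simp
  have "measure_pmf.prob ring {T. T \<subseteq> W}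
      = (\<Sum>j=1..r. pmf \<mu> j * (real (card W choose k j) / real (P choose k j)))"
  proof -
    have "{S. S \<subseteq> {1..P} \<and> card S = m \<and> S \<in> {T. T \<subseteq> W}} = {S. S \<subseteq> W \<and> card S = m}" for m
      using assms by auto
    thus ?thesis using fin by (simp add: prob_ring n_subsets)
  qed
  also have "\<dots> \<le> (\<Sum>j=1..r. pmf \<mu> j * (real (card W) / real P) ^ k 1)"
  proof (intro sum_mono mult_left_mono)
    fix j assume j: "j \<in> {1..r}"
    have "real (card W choose k j) / real (P choose k j) \<le> (real (card W) / real P) ^ k j"
      using card_W size_le_pool[OF j] pool_pos by (rule choose_ratio_le_power)
    also have "\<dots> \<le> (real (card W) / real P) ^ k 1"
      using card_W size_min[OF j] pool_pos by (intro power_decreasing) auto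
    finally show "real (card W choose k j) / real (P choose k j) \<le> (real (card W) / real P) ^ k 1" .
  qed auto
  also have "\<dots> = (real (card W) / real P) ^ k 1"
    using sum_class by (simp flip: sum_distrib_right)
  finally show ?thesis .
qed

lemma prob_ring_card_ge: "pmf \<mu> 1 \<le> measure_pmf.prob ring {T. card T = k 1}"
proof -
  have "pmf \<mu> 1 = pmf \<mu> 1 * (real (card {S. S \<subseteq> {1..P} \<and> card S = k 1 \<and> S \<in> {T. card T = k 1}})
      / real (P choose k 1))"
    using size_le_pool[of 1] r_pos by (simp add: n_subsets)
  also have "\<dots> \<le> measure_pmf.prob ring {T. card T = k 1}"
    unfolding prob_ring using r_pos by (intro member_le_sum) auto
  finally show ?thesis .
qed

lemma avoid_nonneg: "0 \<le> avoid w"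
  unfolding avoid_def by (intro sum_nonneg) auto

lemma avoid_le_1: "avoid w \<le> 1"
proof -
  have "avoid w \<le> (\<Sum>j=1..r. pmf \<mu> j * 1)"
    unfolding avoid_def
  proof (intro sum_mono mult_left_mono)
    fix j assume "j \<in> {1..r}"
    thus "real (P - w choose k j) / real (P choose k j) \<le> 1"
      by (intro choose_diff_ratio_le_1 size_le_pool)
  qed auto
  thus ?thesis using sum_class by simp
qed

lemma avoid_le_laplace:
  assumes "w \<le> P"
  shows "avoid w \<le> laplace (real w / real P)"
  unfolding avoid_def laplace_def
  using choose_diff_ratio_le_exp[OF assms] size_le_pool pool_pos
  by (intro sum_mono mult_left_mono) auto

lemma laplace_nonneg: "0 \<le> laplace t"
  unfolding laplace_def by (intro sum_nonneg) auto

lemma laplace_antimono: "s \<le> t \<Longrightarrow> laplace t \<le> laplace s"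
  unfolding laplace_def by (intro sum_mono mult_left_mono) (auto intro: mult_right_mono)

section \<open>Cuts without edges\<close>

text \<open>
  Given the rings in \<open>S\<close>, the vertices outside \<open>S\<close> independently have to avoid the union of these
  rings. The event \<open>B\<close>, which may only look at the rings in \<open>S\<close>, allows imposing further
  conditions on the block.
\<close>

lemma prob_isolated_block:
  assumes V: "finite V" "S \<subseteq> V"
    and B: "\<And>f g. (\<And>x. x \<in> S \<Longrightarrow> f x = g x) \<Longrightarrow> f \<in> B \<longleftrightarrow> g \<in> B"
  shows "measure_pmf.prob (Pi_pmf V {} (\<lambda>_. ring))
           {\<Sigma>. \<Sigma> \<in> B \<and> (\<forall>x\<in>S. \<forall>y\<in>V - S. \<Sigma> x \<inter> \<Sigma> y = {})}
       = measure_pmf.expectation (Pi_pmf S {} (\<lambda>_. ring))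
           (\<lambda>f. indicator B f * avoid (card (\<Union>x\<in>S. f x)) ^ card (V - S))"
proof -
  have fin: "finite S" using V finite_subset by auto
  define A where "A = {\<Sigma>. \<Sigma> \<in> B \<and> (\<forall>x\<in>S. \<forall>y\<in>V - S. \<Sigma> x \<inter> \<Sigma> y = {})}"
  have "Pi_pmf V {} (\<lambda>_. ring) = map_pmf (\<lambda>(f, g) x. if x \<in> S then f x else g x)
      (pair_pmf (Pi_pmf S {} (\<lambda>_. ring)) (Pi_pmf (V - S) {} (\<lambda>_. ring)))"
    using Pi_pmf_union[of S "V - S" "{}" "\<lambda>_. ring"] fin V by (simp add: Un_absorb1)
  hence "measure_pmf.prob (Pi_pmf V {} (\<lambda>_. ring)) A
      = measure_pmf.expectation (Pi_pmf S {} (\<lambda>_. ring)) (\<lambda>f.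
          measure_pmf.prob (Pi_pmf (V - S) {} (\<lambda>_. ring)) {g. (\<lambda>x. if x \<in> S then f x else g x) \<in> A})"
    by (simp add: prob_pair_pmf)
  also have "\<dots> = measure_pmf.expectation (Pi_pmf S {} (\<lambda>_. ring))
           (\<lambda>f. indicator B f * avoid (card (\<Union>x\<in>S. f x)) ^ card (V - S))"
  proof (rule expectation_pmf_cong)
    fix f assume "f \<in> set_pmf (Pi_pmf S {} (\<lambda>_. ring))"
    hence "(\<Union>x\<in>S. f x) \<subseteq> {1..P}"
      by (rule rings_subset_pool[OF fin])
    note av = prob_ring_avoid[OF this]
    have "{g. (\<lambda>x. if x \<in> S then f x else g x) \<in> A}
        = (if f \<in> B then Pi (V - S) (\<lambda>_. {T. T \<inter> (\<Union>x\<in>S. f x) = {}}) else {})"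
    proof -
      have "(\<lambda>x. if x \<in> S then f x else g x) \<in> B \<longleftrightarrow> f \<in> B" for g
        by (rule B) auto
      moreover have "(\<forall>x\<in>S. \<forall>y\<in>V - S. f x \<inter> g y = {})
          \<longleftrightarrow> g \<in> Pi (V - S) (\<lambda>_. {T. T \<inter> (\<Union>x\<in>S. f x) = {}})" for g
        by blast
      ultimately show ?thesis unfolding A_def by auto
    qed
    thus "measure_pmf.prob (Pi_pmf (V - S) {} (\<lambda>_. ring)) {g. (\<lambda>x. if x \<in> S then f x else g x) \<in> A}
        = indicator B f * avoid (card (\<Union>x\<in>S. f x)) ^ card (V - S)"
      using V by (simp add: measure_Pi_pmf_Pi av)
  qed
  finally show ?thesis by (simp add: A_def)
qed

text \<open>
  A union of at most \<open>m\<close> keys is contained in one of the \<open>P choose m\<close> sets of exactly \<open>m\<close> keys, and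
  all rings in \<open>S\<close> must then lie in that set.
\<close>

lemma prob_small_union_le:
  assumes "finite S" "m \<le> P"
  shows "measure_pmf.prob (Pi_pmf S {} (\<lambda>_. ring)) {f. card (\<Union>x\<in>S. f x) \<le> m}
       \<le> real (P choose m) * (real m / real P) ^ (k 1 * card S)"
proof -
  let ?M = "Pi_pmf S {} (\<lambda>_. ring)" and ?T = "{T. T \<subseteq> {1..P} \<and> card T = m}"
  have "measure_pmf.prob ?M {f. card (\<Union>x\<in>S. f x) \<le> m}
      \<le> measure_pmf.prob ?M (\<Union>T\<in>?T. Pi S (\<lambda>_. {X. X \<subseteq> T}))"
  proof (rule measure_pmf.finite_measure_mono_AE)
    show "AE f in measure_pmf ?M. f \<in> {f. card (\<Union>x\<in>S. f x) \<le> m}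
        \<longrightarrow> f \<in> (\<Union>T\<in>?T. Pi S (\<lambda>_. {X. X \<subseteq> T}))"
      unfolding AE_measure_pmf_iff
    proof (intro ballI impI)
      fix f assume f: "f \<in> set_pmf ?M" "f \<in> {f. card (\<Union>x\<in>S. f x) \<le> m}"
      have "(\<Union>x\<in>S. f x) \<subseteq> {1..P}"
        by (rule rings_subset_pool[OF assms(1) f(1)])
      then obtain T where "(\<Union>x\<in>S. f x) \<subseteq> T" "T \<subseteq> {1..P}" "card T = m"
        using exists_subset_between[of "\<Union>x\<in>S. f x" m "{1..P}"] f(2) assms(2) by auto
      thus "f \<in> (\<Union>T\<in>?T. Pi S (\<lambda>_. {X. X \<subseteq> T}))" by auto
    qed
  qed auto
  also have "\<dots> \<le> (\<Sum>T\<in>?T. measure_pmf.prob ?M (Pi S (\<lambda>_. {X. X \<subseteq> T})))"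
    using uniform_finite by (intro measure_pmf.finite_measure_subadditive_finite) auto
  also have "\<dots> \<le> (\<Sum>T\<in>?T. (real m / real P) ^ (k 1 * card S))"
  proof (rule sum_mono)
    fix T assume "T \<in> ?T"
    hence T: "T \<subseteq> {1..P}" "card T = m" by auto
    have "measure_pmf.prob ?M (Pi S (\<lambda>_. {X. X \<subseteq> T})) = measure_pmf.prob ring {X. X \<subseteq> T} ^ card S"
      using assms(1) by (simp add: measure_Pi_pmf_Pi)
    also have "\<dots> \<le> ((real m / real P) ^ k 1) ^ card S"
      using prob_ring_subset_le[OF T(1)] T(2) by (intro power_mono) auto
    finally show "measure_pmf.prob ?M (Pi S (\<lambda>_. {X. X \<subseteq> T})) \<le> (real m / real P) ^ (k 1 * card S)"
      by (simp add: power_mult)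
  qed
  also have "\<dots> = real (P choose m) * (real m / real P) ^ (k 1 * card S)"
    by (simp add: n_subsets)
  finally show ?thesis .
qed

text \<open>
  The threshold \<open>u\<close> separates two unlikely reasons for the absence of edges between \<open>S\<close> and its
  complement: either the rings in \<open>S\<close> together use few keys, or many keys are all avoided by the
  rings outside \<open>S\<close>.
\<close>

lemma prob_cut_le:
  assumes V: "finite V" "S \<subseteq> V" and u: "0 \<le> u" "u \<le> real P"
  shows "measure_pmf.prob (Pi_pmf V {} (\<lambda>_. ring)) {\<Sigma>. \<forall>x\<in>S. \<forall>y\<in>V - S. \<Sigma> x \<inter> \<Sigma> y = {}}
       \<le> real (P choose nat \<lfloor>u\<rfloor>) * (real (nat \<lfloor>u\<rfloor>) / real P) ^ (k 1 * card S)
         + laplace (u / real P) ^ card (V - S)"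
proof -
  have fin: "finite S" using V finite_subset by auto
  let ?M = "Pi_pmf S {} (\<lambda>_. ring)" and ?m = "nat \<lfloor>u\<rfloor>"
  let ?U = "\<lambda>f. \<Union>x\<in>S. f x"
  have m: "?m \<le> P" using u by linarith
  have "measure_pmf.prob (Pi_pmf V {} (\<lambda>_. ring)) {\<Sigma>. \<forall>x\<in>S. \<forall>y\<in>V - S. \<Sigma> x \<inter> \<Sigma> y = {}}
      = measure_pmf.expectation ?M (\<lambda>f. avoid (card (?U f)) ^ card (V - S))"
    using prob_isolated_block[OF V, of UNIV] by simp
  also have "\<dots> \<le> measure_pmf.expectation ?M
      (\<lambda>f. indicator {f. card (?U f) \<le> ?m} f + laplace (u / real P) ^ card (V - S))"
  proof (rule integral_mono_AE)
    show "integrable ?M (\<lambda>f. avoid (card (?U f)) ^ card (V - S))"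
      using avoid_le_1 avoid_nonneg
      by (intro measure_pmf.integrable_const_bound[where B = 1]) (auto intro!: power_le_one)
    show "integrable ?M (\<lambda>f. indicator {f. card (?U f) \<le> ?m} f + laplace (u / real P) ^ card (V - S))"
      by (intro Bochner_Integration.integrable_add integrable_indicator_pmf) auto
    show "AE f in measure_pmf ?M. avoid (card (?U f)) ^ card (V - S)
        \<le> indicator {f. card (?U f) \<le> ?m} f + laplace (u / real P) ^ card (V - S)"
      unfolding AE_measure_pmf_iff
    proof
      fix f assume "f \<in> set_pmf ?M"
      hence sub: "?U f \<subseteq> {1..P}"
        by (rule rings_subset_pool[OF fin])
      show "avoid (card (?U f)) ^ card (V - S)
        \<le> indicator {f. card (?U f) \<le> ?m} f + laplace (u / real P) ^ card (V - S)"
      proof (cases "card (?U f) \<le> ?m")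
        case True
        thus ?thesis using avoid_le_1 avoid_nonneg laplace_nonneg
          by (auto intro!: order_trans[OF power_le_one])
      next
        case False
        hence "u \<le> real (card (?U f))" by linarith
        moreover have "card (?U f) \<le> P" using card_mono[OF _ sub] by simp
        ultimately have "avoid (card (?U f)) \<le> laplace (u / real P)"
          by (intro order_trans[OF avoid_le_laplace laplace_antimono] divide_right_mono) auto
        thus ?thesis using False avoid_nonneg by (auto intro!: power_mono)
      qed
    qed
  qed
  also have "\<dots> = measure_pmf.prob ?M {f. card (?U f) \<le> ?m} + laplace (u / real P) ^ card (V - S)"
    by (subst Bochner_Integration.integral_add) (auto intro: integrable_indicator_pmf)
  also have "\<dots> \<le> real (P choose ?m) * (real ?m / real P) ^ (k 1 * card S)
      + laplace (u / real P) ^ card (V - S)"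
    using prob_small_union_le[OF fin m] by simp
  finally show ?thesis .
qed

end

section \<open>Connectivity and cuts\<close>

lemma connected_key_graph:
  "Digraph_Component.connected (with_proj (key_graph n \<Sigma>)) \<longleftrightarrow>
     1 \<le> n \<and> (\<forall>u\<in>{1..n}. \<forall>v\<in>{1..n}. (u, v) \<in> rtrancl_on {1..n} (parcs (key_graph n \<Sigma>)))"
proof -
  have "(parcs (key_graph n \<Sigma>))\<^sup>s = parcs (key_graph n \<Sigma>)"
    by (auto simp: key_graph_def symcl_def)
  moreover have "arcs_ends (with_proj (key_graph n \<Sigma>)) = parcs (key_graph n \<Sigma>)"
    by (auto simp: arcs_ends_def arc_to_ends_def)
  ultimately show ?thesis by (simp add: connected_conv key_graph_def Suc_le_eq)
qed

text \<open>
  Take the component of some vertex that does not reach everything, or the complement of that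
  component, whichever is smaller.
\<close>

lemma not_connected_imp_small_cut:
  assumes "1 \<le> n" "\<not> Digraph_Component.connected (with_proj (key_graph n \<Sigma>))"
  obtains S where "S \<subseteq> {1..n}" "S \<noteq> {}" "2 * card S \<le> n"
    "\<forall>x\<in>S. \<forall>y\<in>{1..n} - S. \<Sigma> x \<inter> \<Sigma> y = {}"
proof -
  let ?E = "parcs (key_graph n \<Sigma>)"
  obtain u v where uv: "u \<in> {1..n}" "v \<in> {1..n}" "(u, v) \<notin> rtrancl_on {1..n} ?E"
    using assms by (auto simp: connected_key_graph)
  define C where "C = {w \<in> {1..n}. (u, w) \<in> rtrancl_on {1..n} ?E}"
  have C: "C \<subseteq> {1..n}" "u \<in> C" "v \<notin> C" using uv by (auto simp: C_def)
  have cut: "\<Sigma> x \<inter> \<Sigma> y = {}" if "x \<in> C" "y \<in> {1..n} - C" for x y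
  proof (rule ccontr)
    assume "\<Sigma> x \<inter> \<Sigma> y \<noteq> {}"
    hence "(x, y) \<in> ?E" using that by (auto simp: key_graph_def C_def)
    hence "(u, y) \<in> rtrancl_on {1..n} ?E"
      using that by (auto simp: C_def intro: rtrancl_on_into_rtrancl_on)
    thus False using that by (auto simp: C_def)
  qed
  show thesis
  proof (cases "2 * card C \<le> n")
    case True
    thus thesis using C cut by (intro that[of C]) auto
  next
    case False
    moreover have "card ({1..n} - C) = n - card C"
      using C finite_subset by (subst card_Diff_subset) auto
    moreover have "\<forall>x\<in>{1..n} - C. \<forall>y\<in>{1..n} - ({1..n} - C). \<Sigma> x \<inter> \<Sigma> y = {}"
      using cut C(1) by (metis DiffE DiffI Int_commute)
    ultimately show thesis using C uv
      by (intro that[of "{1..n} - C"]) auto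
  qed
qed

lemma isolated_imp_not_connected:
  assumes "2 \<le> n" "x \<in> {1..n}" "\<forall>y\<in>{1..n} - {x}. \<Sigma> x \<inter> \<Sigma> y = {}"
  shows "\<not> Digraph_Component.connected (with_proj (key_graph n \<Sigma>))"
proof
  assume "Digraph_Component.connected (with_proj (key_graph n \<Sigma>))"
  moreover obtain y where y: "y \<in> {1..n}" "y \<noteq> x"
    using assms(1) by (cases "x = 1") (auto intro: that[of 1] that[of 2])
  ultimately have "(x, y) \<in> rtrancl_on {1..n} (parcs (key_graph n \<Sigma>))"
    using assms(2) by (auto simp: connected_key_graph)
  hence "(x, y) \<in> (parcs (key_graph n \<Sigma>))\<^sup>*" by (rule rtrancl_on_rtranclI)
  then obtain z where "(x, z) \<in> parcs (key_graph n \<Sigma>)"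
    using y by (metis converse_rtranclE)
  thus False using assms(3) by (auto simp: key_graph_def)
qed

section \<open>The second moment method\<close>

text \<open>
  Chebyshev's inequality for the number of events that occur: if none of them occurs, this number
  deviates from its mean \<open>m\<close> by \<open>m\<close>.
\<close>

lemma prob_none_le_second_moment:
  fixes A :: "'i \<Rightarrow> 'a set" and M :: "'a pmf"
  assumes I: "finite I" and m: "m = (\<Sum>i\<in>I. measure_pmf.prob M (A i))" "0 < m"
  shows "measure_pmf.prob M {x. \<forall>i\<in>I. x \<notin> A i}
       \<le> (\<Sum>i\<in>I. \<Sum>j\<in>I. measure_pmf.prob M (A i \<inter> A j)) / m\<^sup>2 - 1"
proof -
  define X where "X x = (\<Sum>i\<in>I. indicator (A i) x :: real)" for x
  have EX: "measure_pmf.expectation M X = m"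
    unfolding X_def m by (subst Bochner_Integration.integral_sum) (auto intro: integrable_indicator_pmf)
  have X2: "(X x)\<^sup>2 = (\<Sum>i\<in>I. \<Sum>j\<in>I. indicator (A i \<inter> A j) x)" for x
    by (simp add: X_def power2_eq_square sum_product indicator_inter_arith)
  have int2: "integrable (measure_pmf M) (\<lambda>x. (X x)\<^sup>2)"
    unfolding X2 by (intro Bochner_Integration.integrable_sum integrable_indicator_pmf)
  have int: "integrable (measure_pmf M) X"
    unfolding X_def by (intro Bochner_Integration.integrable_sum integrable_indicator_pmf)
  have EX2: "measure_pmf.expectation M (\<lambda>x. (X x)\<^sup>2) = (\<Sum>i\<in>I. \<Sum>j\<in>I. measure_pmf.prob M (A i \<inter> A j))"
    unfolding X2 by (simp add: Bochner_Integration.integral_sum Bochner_Integration.integrable_sum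
        integrable_indicator_pmf)
  have "measure_pmf.prob M {x. \<forall>i\<in>I. x \<notin> A i}
      \<le> measure_pmf.prob M {x\<in>space (measure_pmf M). m \<le> \<bar>X x - measure_pmf.expectation M X\<bar>}"
  proof (rule measure_pmf.finite_measure_mono)
    show "{x. \<forall>i\<in>I. x \<notin> A i} \<subseteq> {x\<in>space (measure_pmf M). m \<le> \<bar>X x - measure_pmf.expectation M X\<bar>}"
      using m(2) by (auto simp: EX X_def)
  qed auto
  also have "\<dots> \<le> measure_pmf.variance M X / m\<^sup>2"
    by (rule measure_pmf.Chebyshev_inequality[OF _ int2 m(2)]) auto
  also have "measure_pmf.variance M X = measure_pmf.expectation M (\<lambda>x. (X x)\<^sup>2) - m\<^sup>2"
    using measure_pmf.variance_eq[OF int int2] EX by simp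
  finally show ?thesis using m(2) by (simp add: EX2 diff_divide_distrib)
qed

section \<open>Isolated vertices with the smallest ring size\<close>

context key_rings begin

text \<open>
  A vertex of the first class cannot be recognised from its ring, since other classes may have the
  same ring size. Counting the vertices with the smallest ring size instead does no harm: their
  rings are equally hard to avoid, and they are at least as frequent.
\<close>

lemma prob_isolated_smallest:
  assumes "x \<in> {1..n}"
  shows "measure_pmf.prob (Pi_pmf {1..n} {} (\<lambda>_. ring))
           {\<Sigma>. card (\<Sigma> x) = k 1 \<and> (\<forall>y\<in>{1..n} - {x}. \<Sigma> x \<inter> \<Sigma> y = {})}
       = measure_pmf.prob ring {T. card T = k 1} * avoid (k 1) ^ (n - 1)"
proof -
  let ?B = "{f. card (f x) = k 1}"
  have "measure_pmf.prob (Pi_pmf {1..n} {} (\<lambda>_. ring))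
           {\<Sigma>. card (\<Sigma> x) = k 1 \<and> (\<forall>y\<in>{1..n} - {x}. \<Sigma> x \<inter> \<Sigma> y = {})}
      = measure_pmf.expectation (Pi_pmf {x} {} (\<lambda>_. ring)) (\<lambda>f. indicator ?B f * avoid (card (f x)) ^ (n - 1))"
    using prob_isolated_block[of "{1..n}" "{x}" ?B] assms by simp
  also have "(\<lambda>f. indicator ?B f * avoid (card (f x)) ^ (n - 1))
      = (\<lambda>f. indicator ?B f * avoid (k 1) ^ (n - 1))"
    by (auto simp: indicator_def)
  also have "measure_pmf.expectation (Pi_pmf {x} {} (\<lambda>_. ring)) \<dots>
      = measure_pmf.prob (Pi_pmf {x} {} (\<lambda>_. ring)) ?B * avoid (k 1) ^ (n - 1)"
    by simp
  also have "?B = Pi {x} (\<lambda>_. {T. card T = k 1})" by auto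
  also have "measure_pmf.prob (Pi_pmf {x} {} (\<lambda>_. ring)) \<dots> = measure_pmf.prob ring {T. card T = k 1}"
    by (subst measure_Pi_pmf_Pi) auto
  finally show ?thesis .
qed

lemma prob_two_isolated_smallest_le:
  assumes "x \<in> {1..n}" "y \<in> {1..n}" "x \<noteq> y"
  shows "measure_pmf.prob (Pi_pmf {1..n} {} (\<lambda>_. ring))
           ({\<Sigma>. card (\<Sigma> x) = k 1 \<and> (\<forall>z\<in>{1..n} - {x}. \<Sigma> x \<inter> \<Sigma> z = {})} \<inter>
            {\<Sigma>. card (\<Sigma> y) = k 1 \<and> (\<forall>z\<in>{1..n} - {y}. \<Sigma> y \<inter> \<Sigma> z = {})})
       \<le> (measure_pmf.prob ring {T. card T = k 1})\<^sup>2 * avoid (2 * k 1) ^ (n - 2)"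
proof -
  let ?M = "Pi_pmf {x, y} {} (\<lambda>_. ring)"
  let ?B = "{f. card (f x) = k 1 \<and> card (f y) = k 1 \<and> f x \<inter> f y = {}}"
  let ?C = "Pi {x, y} (\<lambda>_. {T. card T = k 1})"
  have "measure_pmf.prob (Pi_pmf {1..n} {} (\<lambda>_. ring))
           ({\<Sigma>. card (\<Sigma> x) = k 1 \<and> (\<forall>z\<in>{1..n} - {x}. \<Sigma> x \<inter> \<Sigma> z = {})} \<inter>
            {\<Sigma>. card (\<Sigma> y) = k 1 \<and> (\<forall>z\<in>{1..n} - {y}. \<Sigma> y \<inter> \<Sigma> z = {})})
      \<le> measure_pmf.prob (Pi_pmf {1..n} {} (\<lambda>_. ring))
           {\<Sigma>. \<Sigma> \<in> ?B \<and> (\<forall>x'\<in>{x, y}. \<forall>z\<in>{1..n} - {x, y}. \<Sigma> x' \<inter> \<Sigma> z = {})}"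
    using assms by (intro measure_pmf.finite_measure_mono) auto
  also have "\<dots> = measure_pmf.expectation ?M
      (\<lambda>f. indicator ?B f * avoid (card (\<Union>z\<in>{x, y}. f z)) ^ card ({1..n} - {x, y}))"
    using assms by (intro prob_isolated_block) auto
  also have "\<dots> = measure_pmf.expectation ?M (\<lambda>f. indicator ?B f * avoid (2 * k 1) ^ (n - 2))"
  proof (intro expectation_pmf_cong)
    fix f
    have "card (f x \<union> f y) = 2 * k 1" if "f \<in> ?B"
      using that size_pos by (subst card_Un_disjoint) (auto intro: card_ge_0_finite)
    moreover have "card ({1..n} - {x, y}) = n - 2" using assms by (simp add: card_Diff_subset)
    ultimately show "indicator ?B f * avoid (card (\<Union>z\<in>{x, y}. f z)) ^ card ({1..n} - {x, y})
        = indicator ?B f * avoid (2 * k 1) ^ (n - 2)"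
      by (auto simp: indicator_def)
  qed
  also have "\<dots> = measure_pmf.prob ?M ?B * avoid (2 * k 1) ^ (n - 2)"
    by simp
  also have "\<dots> \<le> measure_pmf.prob ?M ?C * avoid (2 * k 1) ^ (n - 2)"
    using avoid_nonneg by (intro mult_right_mono measure_pmf.finite_measure_mono) auto
  also have "measure_pmf.prob ?M ?C = (measure_pmf.prob ring {T. card T = k 1})\<^sup>2"
    using assms by (subst measure_Pi_pmf_Pi) (auto simp: power2_eq_square)
  finally show ?thesis .
qed

text \<open>
  With \<open>q\<^sub>j\<close> the probability that a class \<open>j\<close> ring avoids \<open>K\<^sub>1\<close> given keys, the left-hand side is at
  most the mean of \<open>q\<^sub>j\<^sup>2\<close> over the classes, which exceeds the square of the mean by the variance of
  \<open>1 - q\<^sub>j\<close>. As \<open>\<mu>\<^sub>j (1 - q\<^sub>j)\<close> is at most the mean \<open>\<lambda> = 1 - avoid (k 1)\<close>, this variance is of order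
  \<open>\<lambda>\<^sup>2\<close>.
\<close>

lemma avoid_double_le:
  "avoid (2 * k 1) \<le> (avoid (k 1))\<^sup>2 + (\<Sum>j=1..r. 1 / pmf \<mu> j) * (1 - avoid (k 1))\<^sup>2"
proof -
  define q where "q j = real (P - k 1 choose k j) / real (P choose k j)" for j
  let ?l = "1 - avoid (k 1)"
  have q1: "q j \<le> 1" if "j \<in> {1..r}" for j
    unfolding q_def by (intro choose_diff_ratio_le_1 size_le_pool that)
  have l: "?l = (\<Sum>j=1..r. pmf \<mu> j * (1 - q j))"
    using sum_class by (simp add: avoid_def q_def algebra_simps sum_subtractf)
  have "avoid (2 * k 1) \<le> (\<Sum>j=1..r. pmf \<mu> j * (q j)\<^sup>2)"
    unfolding avoid_def
  proof (intro sum_mono mult_left_mono)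
    fix j assume j: "j \<in> {1..r}"
    have "real ((P - 2 * k 1 choose k j) * (P choose k j)) \<le> real ((P - k 1 choose k j)\<^sup>2)"
      using choose_log_concave by (simp only: of_nat_le_iff)
    moreover have "0 < real (P choose k j)" using size_le_pool[OF j] by simp
    ultimately show "real (P - 2 * k 1 choose k j) / real (P choose k j) \<le> (q j)\<^sup>2"
      unfolding q_def by (simp add: power_divide field_simps power2_eq_square)
  qed auto
  also have "\<dots> = (\<Sum>j=1..r. pmf \<mu> j - 2 * (pmf \<mu> j * (1 - q j)) + pmf \<mu> j * (1 - q j)\<^sup>2)"
    by (intro sum.cong) (auto simp: power2_eq_square algebra_simps)
  also have "\<dots> = 1 - 2 * ?l + (\<Sum>j=1..r. pmf \<mu> j * (1 - q j)\<^sup>2)"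
    unfolding l using sum_class by (simp add: sum.distrib sum_subtractf sum_distrib_left)
  also have "(\<Sum>j=1..r. pmf \<mu> j * (1 - q j)\<^sup>2) \<le> (\<Sum>j=1..r. 1 / pmf \<mu> j * ?l\<^sup>2)"
  proof (rule sum_mono)
    fix j assume j: "j \<in> {1..r}"
    have "pmf \<mu> j * (1 - q j) \<le> ?l"
      unfolding l using j q1 by (intro member_le_sum[of j]) auto
    hence "(pmf \<mu> j * (1 - q j))\<^sup>2 \<le> ?l\<^sup>2"
      using q1[OF j] by (intro power_mono) auto
    thus "pmf \<mu> j * (1 - q j)\<^sup>2 \<le> 1 / pmf \<mu> j * ?l\<^sup>2"
      using class_pos[OF j] by (simp add: field_simps power2_eq_square)
  qed
  also have "(\<Sum>j=1..r. 1 / pmf \<mu> j * ?l\<^sup>2) = (\<Sum>j=1..r. 1 / pmf \<mu> j) * ?l\<^sup>2"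
    by (rule sum_distrib_right[symmetric])
  also have "1 - 2 * ?l \<le> (avoid (k 1))\<^sup>2"
    using zero_le_power2[of ?l] by (simp add: power2_eq_square algebra_simps)
  finally show ?thesis by simp
qed

text \<open>
  The second moment bound, with the ratio of the second moment to the squared first moment
  spelled out. The first term comes from the diagonal pairs, and the others from pairs of distinct
  vertices.
\<close>

lemma prob_connected_le:
  assumes n: "2 \<le> n" and pos: "0 < avoid (k 1)"
  shows "measure_pmf.prob (random_key_graph n \<mu> k P) {G. Digraph_Component.connected (with_proj G)}
       \<le> 1 / (real n * pmf \<mu> 1 * avoid (k 1) ^ (n - 1))
         + exp (real n * ((\<Sum>j=1..r. 1 / pmf \<mu> j) * (1 - avoid (k 1))\<^sup>2 / (avoid (k 1))\<^sup>2))
             / (avoid (k 1))\<^sup>2 - 1"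
proof -
  define a where "a = measure_pmf.prob ring {T. card T = k 1}"
  define q where "q = avoid (k 1)"
  define D where "D = (\<Sum>j=1..r. 1 / pmf \<mu> j) * (1 - q)\<^sup>2 / q\<^sup>2"
  let ?M = "Pi_pmf {1..n} {} (\<lambda>_. ring)"
  define A where "A x = {\<Sigma> :: nat \<Rightarrow> nat set. card (\<Sigma> x) = k 1 \<and> (\<forall>y\<in>{1..n} - {x}. \<Sigma> x \<inter> \<Sigma> y = {})}" for x :: nat
  have a: "0 < pmf \<mu> 1" "pmf \<mu> 1 \<le> a"
    using class_pos[of 1] r_pos prob_ring_card_ge by (auto simp: a_def)
  have q: "0 < q" using pos by (simp add: q_def)
  have D0: "0 \<le> D" using class_pos unfolding D_def by (intro divide_nonneg_nonneg mult_nonneg_nonneg sum_nonneg) auto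
  define m where "m = (\<Sum>x\<in>{1..n}. measure_pmf.prob ?M (A x))"
  have PA: "measure_pmf.prob ?M (A x) = a * q ^ (n - 1)" if "x \<in> {1..n}" for x
    using prob_isolated_smallest[OF that] by (simp add: A_def a_def q_def)
  have "m = (\<Sum>x\<in>{1..n}. a * q ^ (n - 1))"
    unfolding m_def by (rule sum.cong[OF refl PA])
  hence m: "m = real n * (a * q ^ (n - 1))" by simp
  have m_pos: "0 < m" using a q n by (simp add: m)
  have "measure_pmf.prob (random_key_graph n \<mu> k P) {G. Digraph_Component.connected (with_proj G)}
      \<le> measure_pmf.prob ?M {\<Sigma>. \<forall>x\<in>{1..n}. \<Sigma> \<notin> A x}"
    unfolding random_key_graph_def measure_map_pmf
  proof (rule measure_pmf.finite_measure_mono)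
    show "key_graph n -` {G. Digraph_Component.connected (with_proj G)} \<subseteq> {\<Sigma>. \<forall>x\<in>{1..n}. \<Sigma> \<notin> A x}"
    proof (intro subsetI CollectI ballI notI)
      fix \<Sigma> x assume "\<Sigma> \<in> key_graph n -` {G. Digraph_Component.connected (with_proj G)}"
        and x: "x \<in> {1..n}" "\<Sigma> \<in> A x"
      moreover have "\<forall>y\<in>{1..n} - {x}. \<Sigma> x \<inter> \<Sigma> y = {}" using x by (simp add: A_def)
      ultimately show False using isolated_imp_not_connected[OF n x(1)] by simp
    qed
  qed auto
  also have "\<dots> \<le> (\<Sum>x\<in>{1..n}. \<Sum>y\<in>{1..n}. measure_pmf.prob ?M (A x \<inter> A y)) / m\<^sup>2 - 1"
    using m_pos by (intro prob_none_le_second_moment) (auto simp: m_def)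
  also have "(\<Sum>x\<in>{1..n}. \<Sum>y\<in>{1..n}. measure_pmf.prob ?M (A x \<inter> A y))
      \<le> (\<Sum>x\<in>{1..n}. \<Sum>y\<in>{1..n}. (if y = x then a * q ^ (n - 1) else 0) + a\<^sup>2 * avoid (2 * k 1) ^ (n - 2))"
  proof (intro sum_mono)
    fix x y assume xy: "x \<in> {1..n}" "y \<in> {1..n}"
    show "measure_pmf.prob ?M (A x \<inter> A y)
        \<le> (if y = x then a * q ^ (n - 1) else 0) + a\<^sup>2 * avoid (2 * k 1) ^ (n - 2)"
    proof (cases "x = y")
      case True
      thus ?thesis using PA[OF xy(1)] avoid_nonneg by simp
    next
      case False
      thus ?thesis using prob_two_isolated_smallest_le[OF xy False] by (simp add: A_def a_def)
    qed
  qed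
  also have "\<dots> = m + (real n)\<^sup>2 * (a\<^sup>2 * avoid (2 * k 1) ^ (n - 2))"
    by (simp add: sum.distrib m power2_eq_square distrib_left)
  also have "\<dots> \<le> m + (real n)\<^sup>2 * (a\<^sup>2 * (q\<^sup>2 * exp D) ^ (n - 2))"
  proof -
    have "avoid (2 * k 1) \<le> q\<^sup>2 * (1 + D)"
    proof -
      have "q\<^sup>2 * (1 + D) = q\<^sup>2 + (\<Sum>j=1..r. 1 / pmf \<mu> j) * (1 - q)\<^sup>2"
        using q by (simp add: D_def distrib_left)
      thus ?thesis using avoid_double_le by (simp add: q_def)
    qed
    also have "\<dots> \<le> q\<^sup>2 * exp D" by (intro mult_left_mono exp_ge_add_one_self) auto
    finally show ?thesis using avoid_nonneg
      by (intro add_left_mono mult_left_mono power_mono) auto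
  qed
  also have "\<dots> = m + m\<^sup>2 * (exp (real (n - 2) * D) / q\<^sup>2)"
  proof -
    have "q ^ (n - 1) = q ^ (n - 2) * q" using n by (simp flip: power_Suc2 add: Suc_diff_Suc numeral_2_eq_2)
    thus ?thesis using q
      by (simp add: m power_mult_distrib exp_of_nat_mult exp_of_nat2_mult power2_eq_square field_simps)
  qed
  also have "\<dots> \<le> m + m\<^sup>2 * (exp (real n * D) / q\<^sup>2)"
    using D0 by (intro add_left_mono mult_left_mono divide_right_mono) (auto intro!: mult_right_mono)
  finally have "measure_pmf.prob (random_key_graph n \<mu> k P) {G. Digraph_Component.connected (with_proj G)}
      \<le> (m + m\<^sup>2 * (exp (real n * D) / q\<^sup>2)) / m\<^sup>2 - 1"
    using m_pos by (simp add: divide_right_mono)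
  also have "\<dots> = 1 / m + exp (real n * D) / q\<^sup>2 - 1"
    using m_pos by (simp add: add_divide_distrib power2_eq_square)
  also have "1 / m \<le> 1 / (real n * pmf \<mu> 1 * q ^ (n - 1))"
    unfolding m mult.assoc using a q n by (intro divide_left_mono mult_left_mono mult_right_mono) auto
  finally show ?thesis by (simp add: q_def D_def)
qed

end

section \<open>Elementary estimates\<close>

text \<open>
  Of the \<open>N\<close> factors \<open>m / b\<close>, with \<open>m\<close> the integer part of \<open>u\<close>, only \<open>m\<close> are spent on cancelling
  the binomial coefficient up to \<open>e\<^bsup>N\<^esup>\<close>; at least \<open>\<delta> N\<close> of them remain.
\<close>

lemma union_bound_le_powr:
  assumes \<delta>: "0 < \<delta>" and u: "0 < u" "u \<le> (1 - \<delta>) * real N" "u \<le> real b"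
  shows "real (b choose nat \<lfloor>u\<rfloor>) * (real (nat \<lfloor>u\<rfloor>) / real b) ^ N
       \<le> exp (real N) * (u / real b) powr (\<delta> * real N)"
proof (cases "nat \<lfloor>u\<rfloor> = 0")
  case True
  have "N \<noteq> 0" using u by (intro notI) simp
  thus ?thesis unfolding True by (simp add: power_0_left)
next
  case False
  define m where "m = nat \<lfloor>u\<rfloor>"
  have m: "0 < m" "real m \<le> u" using False u by (auto simp: m_def)
  have b: "0 < real b" using u by linarith
  have "(1 - \<delta>) * real N \<le> real N" using \<delta> by (simp add: algebra_simps)
  hence mN: "m \<le> N" using m u by linarith
  have "real (b choose m) * (real m / real b) ^ N
      = real (b choose m) * (real m / real b) ^ m * (real m / real b) ^ (N - m)"
    using mN by (simp flip: power_add)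
  also have "\<dots> \<le> exp (real N) * (u / real b) powr (\<delta> * real N)"
  proof (rule mult_mono)
    show "real (b choose m) * (real m / real b) ^ m \<le> exp (real N)"
      using choose_mult_pow_le_exp[of b m] mN by (smt (verit) exp_le_cancel_iff of_nat_le_iff)
    have "(real m / real b) ^ (N - m) = (real m / real b) powr (real N - real m)"
      using m b mN by (simp add: of_nat_diff flip: powr_realpow)
    also have "\<dots> \<le> (u / real b) powr (real N - real m)"
      using m b mN by (intro powr_mono2 divide_right_mono) auto
    also have "\<dots> \<le> (u / real b) powr (\<delta> * real N)"
      using m u b by (intro powr_mono') (auto simp: algebra_simps)
    finally show "(real m / real b) ^ (N - m) \<le> (u / real b) powr (\<delta> * real N)" .
  qed auto
  finally show ?thesis by (simp add: m_def)
qed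

text \<open>
  Here \<open>x = l / n\<close> is the relative block size, \<open>K\<close> the smallest ring size and \<open>t = u / P\<close>; the left
  side is the cost per vertex of a small union, and the factor \<open>x\<close> on the right pays for the
  choice of the block. There are two bounds on \<open>t\<close>. If \<open>x \<ge> e\<^bsup>-K\<^esup>\<close> the constant one suffices, as it
  already gives \<open>t\<^bsup>\<delta> K\<^esup> \<le> e\<^bsup>-3 K\<^esup>\<close>. Otherwise \<open>x\<close> is so small that the linear one yields
  \<open>t \<le> \<surd>x\<close>, and then \<open>t\<^bsup>\<delta> K\<^esup> \<le> x\<^sup>3\<close>.
\<close>

lemma overlap_cost_le:
  fixes \<delta> \<sigma> x K t :: real
  assumes "0 < \<delta>" "0 < \<sigma>" "0 < x" "6 / \<delta> \<le> K" "K * exp (- K / 2) \<le> \<sigma>"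
    and t: "0 < t" "t \<le> exp (- 3 / \<delta>)" "t \<le> x * K / \<sigma>"
  shows "exp K * t powr (\<delta> * K) \<le> x * exp (- K)"
proof -
  have K: "6 \<le> \<delta> * K" using assms by (simp add: field_simps)
  have K0: "0 < K" using K assms(1) by (smt (verit) zero_less_mult_iff)
  have lnt: "ln t \<le> - 3 / \<delta>" using t by (metis exp_gt_zero ln_exp ln_le_cancel_iff)
  have "K + \<delta> * K * ln t \<le> ln x - K"
  proof (cases "- K \<le> ln x")
    case True
    have "\<delta> * K * ln t \<le> \<delta> * K * (- 3 / \<delta>)"
      using lnt K by (intro mult_left_mono) auto
    also have "\<dots> = - 3 * K" using assms(1) by simp
    finally show ?thesis using True by simp
  next
    case False
    have "sqrt x \<le> exp (- K / 2)"
    proof -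
      have "x \<le> exp (- K)" using False assms(3) by (metis exp_le_cancel_iff exp_ln linear)
      also have "\<dots> = (exp (- K / 2))\<^sup>2" by (simp add: power2_eq_square flip: exp_add)
      finally show ?thesis by (intro real_le_lsqrt) auto
    qed
    hence "sqrt x * K \<le> exp (- K / 2) * K" using K0 by (intro mult_right_mono) auto
    hence "sqrt x * K / \<sigma> \<le> 1" using assms by (simp add: mult.commute)
    hence "sqrt x * (sqrt x * K / \<sigma>) \<le> sqrt x * 1" using assms(3) by (intro mult_left_mono) auto
    moreover have "x * K / \<sigma> = sqrt x * (sqrt x * K / \<sigma>)"
      using assms(3) real_sqrt_mult_self[of x] by (simp only: times_divide_eq_right mult.assoc[symmetric])
    ultimately have "t \<le> sqrt x" using t(3) by (simp only: mult_1_right)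
    hence "ln t \<le> ln (sqrt x)" using t(1) assms(3) by (subst ln_le_cancel_iff) auto
    hence "ln t \<le> ln x / 2" using assms(3) by (simp add: ln_sqrt)
    moreover have "\<delta> * K * ln t \<le> 6 * ln t"
      using K lnt assms(1) by (intro mult_right_mono_neg) (auto intro: order_trans)
    ultimately show ?thesis using False by simp
  qed
  hence "exp (K + \<delta> * K * ln t) \<le> exp (ln x - K)" by simp
  thus ?thesis using assms(3) t(1) by (simp add: powr_def exp_add exp_diff exp_minus field_simps)
qed

text \<open>
  Choosing a small fraction of the vertices has small entropy. With \<open>x = l / n\<close>, the exponent per
  vertex is \<open>x (1 - ln x)\<close>, and \<open>2 \<surd>x\<close> is a crude but explicit bound for it.
\<close>

lemma choose_le_exp_sqrt:
  assumes "1 \<le> l" "real l \<le> \<beta> * real n" "\<beta> \<le> 1"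
  shows "real (n choose l) \<le> exp (2 * sqrt \<beta> * real n)"
proof -
  have n: "0 < real n" using assms by (cases "n = 0") auto
  define x where "x = real l / real n"
  have x: "0 < x" "x \<le> \<beta>" using assms n by (auto simp: x_def field_simps)
  have "real (n choose l) * x ^ l \<le> exp (real l)"
    unfolding x_def by (rule choose_mult_pow_le_exp)
  hence "real (n choose l) \<le> exp (real l) / x ^ l" using x by (simp add: field_simps)
  also have "\<dots> = exp (real n * (x * (1 - ln x)))"
  proof -
    have "x ^ l = exp (real l * ln x)" using x by (simp add: exp_of_nat_mult)
    thus ?thesis using n by (simp add: x_def right_diff_distrib flip: exp_diff)
  qed
  also have "\<dots> \<le> exp (real n * (2 * sqrt \<beta>))"
  proof -
    have "ln (1 / sqrt x) \<le> 1 / sqrt x - 1" using x by (intro ln_le_minus_one) auto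
    hence "- ln x \<le> 2 / sqrt x - 2" using x by (simp add: ln_div ln_sqrt)
    hence "x * (- ln x) \<le> x * (2 / sqrt x - 2)" using x by (intro mult_left_mono) auto
    also have "\<dots> = 2 * sqrt x - 2 * x"
      using x by (simp add: field_simps)
    finally have "x * (1 - ln x) \<le> 2 * sqrt x" using x by (simp add: algebra_simps)
    also have "\<dots> \<le> 2 * sqrt \<beta>" using x by simp
    finally show ?thesis using n by simp
  qed
  finally show ?thesis by (simp add: mult_ac)
qed

lemma sum_power_le_geometric:
  fixes x :: real
  assumes "0 \<le> x" "x < 1"
  shows "(\<Sum>l=1..m. x ^ l) \<le> x / (1 - x)"
proof -
  have "(\<Sum>l=1..m. x ^ l) * (1 - x) = x - x ^ Suc m"
  proof (induction m)
    case (Suc m)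
    have "(\<Sum>l=1..Suc m. x ^ l) * (1 - x) = (\<Sum>l=1..m. x ^ l) * (1 - x) + x ^ Suc m * (1 - x)"
      by (simp add: distrib_right)
    also have "\<dots> = x - x ^ Suc (Suc m)" unfolding Suc.IH by (simp add: algebra_simps)
    finally show ?case .
  qed simp
  also have "\<dots> \<le> x" using assms by simp
  finally show ?thesis using assms by (simp add: field_simps)
qed

lemma exp_minus_le_linear:
  fixes y :: real
  assumes "0 \<le> y" "y \<le> \<delta>"
  shows "exp (- y) \<le> 1 - (1 - \<delta>) * y"
proof -
  have "1 + y \<le> exp y" by (rule exp_ge_add_one_self)
  hence "exp (- y) \<le> 1 / (1 + y)" using assms by (simp add: exp_minus field_simps)
  also have "\<dots> \<le> 1 - (1 - y) * y" using assms by (simp add: field_simps)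
  finally have "exp (- y) \<le> 1 - (1 - y) * y" .
  moreover have "(1 - \<delta>) * y \<le> (1 - y) * y" using assms by (intro mult_right_mono) auto
  ultimately show ?thesis by linarith
qed

section \<open>Mean edge probability and ring sizes\<close>

context key_rings begin

definition mean_size :: real where
  "mean_size = (\<Sum>j=1..r. pmf \<mu> j * real (k j))"

lemma mean_edge_le_mean_size: "1 - avoid (k 1) \<le> real (k 1) * mean_size / real P"
proof -
  have "1 - real (k 1) * mean_size / real P
      = (\<Sum>j=1..r. pmf \<mu> j * (1 - real (k 1) * real (k j) / real P))"
    using sum_class
    by (simp add: mean_size_def right_diff_distrib sum_subtractf sum_distrib_left sum_divide_distrib mult_ac)
  also have "\<dots> \<le> avoid (k 1)"
    unfolding avoid_def using choose_diff_ge size_le_pool[of 1] size_le_pool pool_pos r_pos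
    by (intro sum_mono mult_left_mono choose_diff_ge) auto
  finally show ?thesis by simp
qed

text \<open>
  A pair with ring sizes \<open>K\<^sub>1\<close> and \<open>K\<^sub>r\<close> is adjacent with probability at least
  \<open>1 - exp (- K\<^sub>1 K\<^sub>r / P)\<close>, and this event contributes at most the mean edge probability when weighted
  with \<open>\<mu>\<^sub>r\<close>. So a small mean keeps even the largest rings under control.
\<close>

lemma largest_size_le_mean_edge:
  assumes "1 - avoid (k 1) \<le> pmf \<mu> r / 2"
  shows "real (k 1) * real (k r) / real P \<le> 2 / pmf \<mu> r * (1 - avoid (k 1))"
proof -
  define y where "y = real (k 1) * real (k r) / real P"
  define z where "z = (1 - avoid (k 1)) / pmf \<mu> r"
  have r: "r \<in> {1..r}" using r_pos by simp
  note \<mu>r = class_pos[OF r]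
  have ratio: "real (P - k 1 choose k j) / real (P choose k j) \<le> exp (- (real (k 1) / real P * real (k j)))"
    if "j \<in> {1..r}" for j
    by (rule choose_diff_ratio_le_exp[OF _ size_le_pool[OF that]]) (use size_le_pool[of 1] r_pos pool_pos in auto)
  \<comment> \<open>Only the last class is estimated nontrivially.\<close>
  have "avoid (k 1) \<le> (\<Sum>j=1..r. pmf \<mu> j * (if j = r then exp (- y) else 1))"
    unfolding avoid_def
  proof (intro sum_mono mult_left_mono)
    fix j assume j: "j \<in> {1..r}"
    show "real (P - k 1 choose k j) / real (P choose k j) \<le> (if j = r then exp (- y) else 1)"
      using ratio[OF j] by (auto simp: y_def intro: order_trans)
  qed auto
  also have "\<dots> = (\<Sum>j=1..r. pmf \<mu> j + (if j = r then pmf \<mu> r * (exp (- y) - 1) else 0))"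
    by (intro sum.cong) (auto simp: algebra_simps)
  also have "\<dots> = 1 + pmf \<mu> r * (exp (- y) - 1)"
    using r sum_class by (simp add: sum.distrib)
  finally have "1 - z \<le> exp (- y)"
    using \<mu>r by (simp add: z_def field_simps)
  moreover have z: "0 \<le> z" "z \<le> 1 / 2"
    using assms \<mu>r avoid_le_1 by (auto simp: z_def field_simps)
  moreover from z have "0 < 1 - z" by simp
  ultimately have "ln (1 - z) \<le> - y" by (metis exp_gt_zero ln_exp ln_le_cancel_iff)
  moreover have "- z - 2 * z\<^sup>2 \<le> ln (1 - z)"
    using z by (intro ln_one_minus_pos_lower_bound) auto
  moreover have "2 * z\<^sup>2 \<le> z" using mult_left_mono[OF z(2) z(1)] by (simp add: power2_eq_square)
  ultimately have "y \<le> 2 * z" by linarith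
  thus ?thesis by (simp add: y_def z_def)
qed

text \<open>
  As long as \<open>t\<close> times every ring size stays below \<open>\<delta>\<close>, the exponential is nearly linear, and the
  average over the classes can be pulled into the exponent.
\<close>

lemma laplace_le_mean_size:
  assumes "0 \<le> t" "t * real (k r) \<le> \<delta>"
  shows "laplace t \<le> exp (- ((1 - \<delta>) * t * mean_size))"
proof -
  have "laplace t \<le> (\<Sum>j=1..r. pmf \<mu> j * (1 - (1 - \<delta>) * (t * real (k j))))"
    unfolding laplace_def
  proof (intro sum_mono mult_left_mono exp_minus_le_linear)
    fix j assume "j \<in> {1..r}"
    hence "t * real (k j) \<le> t * real (k r)"
      using assms(1) size_max by (intro mult_left_mono) auto
    thus "t * real (k j) \<le> \<delta>" using assms(2) by simp
  qed (use assms in auto)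
  also have "\<dots> = (\<Sum>j=1..r. pmf \<mu> j - (1 - \<delta>) * t * (pmf \<mu> j * real (k j)))"
    by (intro sum.cong) (auto simp: algebra_simps)
  also have "\<dots> = 1 + - ((1 - \<delta>) * t * mean_size)"
    unfolding sum_subtractf sum_class mean_size_def sum_distrib_left[symmetric] by simp
  also have "\<dots> \<le> exp (- ((1 - \<delta>) * t * mean_size))" by (rule exp_ge_add_one_self)
  finally show ?thesis .
qed

lemma laplace_le_smallest:
  assumes "0 \<le> t"
  shows "laplace t \<le> exp (- (t * real (k 1)))"
proof -
  have "laplace t \<le> (\<Sum>j=1..r. pmf \<mu> j * exp (- (t * real (k 1))))"
    unfolding laplace_def using assms size_min
    by (intro sum_mono mult_left_mono) (auto intro: mult_left_mono)
  thus ?thesis using sum_class by (simp flip: sum_distrib_right)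
qed

end

section \<open>Union bound over cuts\<close>

context key_rings begin

lemma prob_not_connected_le:
  assumes "1 \<le> n"
    and cut: "\<And>S. S \<subseteq> {1..n} \<Longrightarrow> S \<noteq> {} \<Longrightarrow> 2 * card S \<le> n \<Longrightarrow>
      measure_pmf.prob (Pi_pmf {1..n} {} (\<lambda>_. ring)) {\<Sigma>. \<forall>x\<in>S. \<forall>y\<in>{1..n} - S. \<Sigma> x \<inter> \<Sigma> y = {}}
        \<le> b (card S)"
  shows "1 - measure_pmf.prob (random_key_graph n \<mu> k P) {G. Digraph_Component.connected (with_proj G)}
       \<le> (\<Sum>l=1..n div 2. real (n choose l) * b l)"
proof -
  let ?M = "Pi_pmf {1..n} {} (\<lambda>_. ring)"
  define F where "F l = {S. S \<subseteq> {1..n} \<and> card S = l}" for l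
  define N where "N S = {\<Sigma> :: nat \<Rightarrow> nat set. \<forall>x\<in>S. \<forall>y\<in>{1..n} - S. \<Sigma> x \<inter> \<Sigma> y = {}}" for S
  have fin: "finite (F l)" for l
    unfolding F_def by (rule finite_subset[of _ "Pow {1..n}"]) auto
  have "1 - measure_pmf.prob (random_key_graph n \<mu> k P) {G. Digraph_Component.connected (with_proj G)}
      = measure_pmf.prob (random_key_graph n \<mu> k P) (- {G. Digraph_Component.connected (with_proj G)})"
    using measure_pmf.prob_compl[of "{G. Digraph_Component.connected (with_proj G)}" "random_key_graph n \<mu> k P"]
    by (simp add: Compl_eq_Diff_UNIV)
  also have "\<dots> \<le> measure_pmf.prob ?M (\<Union>l\<in>{1..n div 2}. \<Union>S\<in>F l. N S)"
    unfolding random_key_graph_def measure_map_pmf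
  proof (rule measure_pmf.finite_measure_mono)
    show "key_graph n -` (- {G. Digraph_Component.connected (with_proj G)})
        \<subseteq> (\<Union>l\<in>{1..n div 2}. \<Union>S\<in>F l. N S)"
    proof
      fix \<Sigma> assume "\<Sigma> \<in> key_graph n -` (- {G. Digraph_Component.connected (with_proj G)})"
      hence "\<not> Digraph_Component.connected (with_proj (key_graph n \<Sigma>))" by simp
      then obtain S where S: "S \<subseteq> {1..n}" "S \<noteq> {}" "2 * card S \<le> n"
          "\<forall>x\<in>S. \<forall>y\<in>{1..n} - S. \<Sigma> x \<inter> \<Sigma> y = {}"
        by (rule not_connected_imp_small_cut[OF assms(1)])
      have "finite S" using S(1) by (rule finite_subset) simp
      hence "0 < card S" using S(2) by (simp add: card_gt_0_iff)
      hence "card S \<in> {1..n div 2}" using S(3) by simp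
      moreover have "S \<in> F (card S)" "\<Sigma> \<in> N S" using S by (simp_all add: F_def N_def)
      ultimately show "\<Sigma> \<in> (\<Union>l\<in>{1..n div 2}. \<Union>S\<in>F l. N S)" by blast
    qed
  qed auto
  also have "\<dots> \<le> (\<Sum>l=1..n div 2. measure_pmf.prob ?M (\<Union>S\<in>F l. N S))"
    by (intro measure_pmf.finite_measure_subadditive_finite) auto
  also have "\<dots> \<le> (\<Sum>l=1..n div 2. real (n choose l) * b l)"
  proof (rule sum_mono)
    fix l assume l: "l \<in> {1..n div 2}"
    have "measure_pmf.prob ?M (\<Union>S\<in>F l. N S) \<le> (\<Sum>S\<in>F l. measure_pmf.prob ?M (N S))"
      using fin by (intro measure_pmf.finite_measure_subadditive_finite) auto
    also have "\<dots> \<le> (\<Sum>S\<in>F l. b l)"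
    proof (rule sum_mono)
      fix S assume "S \<in> F l"
      hence S: "S \<subseteq> {1..n}" "card S = l" by (auto simp: F_def)
      hence "S \<noteq> {}" "2 * card S \<le> n" using l by auto
      from cut[OF S(1) this] show "measure_pmf.prob ?M (N S) \<le> b l" by (simp add: N_def S(2))
    qed
    also have "\<dots> = real (n choose l) * b l"
      unfolding F_def by (simp add: n_subsets)
    finally show "measure_pmf.prob ?M (\<Union>S\<in>F l. N S) \<le> real (n choose l) * b l" .
  qed
  finally show ?thesis .
qed

text \<open>
  The first part of the cut bound, summed over all blocks of \<open>l\<close> vertices. The lower bound on the
  pool enters through \<open>u / P \<le> (l / n) K\<^sub>1 / \<sigma>\<close>.
\<close>

lemma overlap_term_le:
  assumes l: "1 \<le> l" "l \<le> n"
    and pos: "0 < \<delta>" "\<delta> < 1" "0 < \<sigma>" and pool: "\<sigma> * real n \<le> real P"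
    and size: "6 / \<delta> \<le> real (k 1)" "real (k 1) * exp (- real (k 1) / 2) \<le> \<sigma>"
    and u: "u = min ((1 - \<delta>) * (real l * real (k 1))) (exp (- 3 / \<delta>) * real P)"
  shows "real (n choose l) * (real (P choose nat \<lfloor>u\<rfloor>) * (real (nat \<lfloor>u\<rfloor>) / real P) ^ (k 1 * l))
       \<le> exp (1 - real (k 1)) ^ l"
proof -
  define x where "x = real l / real n"
  define K where "K = real (k 1)"
  have n: "0 < real n" using l by simp
  have x: "0 < x" using l n by (simp add: x_def)
  have K: "0 < K" using size_pos by (simp add: K_def)
  have P: "0 < real P" using pool_pos by simp
  have u0: "0 < u" using pos l K P unfolding u K_def by (simp add: min_def)
  have u1: "u \<le> (1 - \<delta>) * real (k 1 * l)" unfolding u by (simp add: mult_ac)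
  have u2: "u / real P \<le> exp (- 3 / \<delta>)" unfolding u using P by (simp add: field_simps)
  have u3: "u \<le> real P"
  proof -
    have "exp (- 3 / \<delta>) \<le> 1" using pos by simp
    thus ?thesis using u2 P by (smt (verit) divide_le_eq_1_pos)
  qed
  have u4: "u / real P \<le> x * K / \<sigma>"
  proof -
    have "u \<le> real l * K"
      using u1 pos mult_right_mono[of "1 - \<delta>" 1 "real (k 1 * l)"] by (simp add: K_def mult_ac)
    hence "u / real P \<le> real l * K / real P" using P by (intro divide_right_mono) auto
    also have "\<dots> \<le> real l * K / (\<sigma> * real n)"
      using pool pos n K P by (intro divide_left_mono mult_pos_pos) auto
    finally show ?thesis by (simp add: x_def field_simps)
  qed
  have "real (n choose l) * x ^ l \<le> exp (real l)"
    unfolding x_def by (rule choose_mult_pow_le_exp)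
  hence choose: "real (n choose l) \<le> exp 1 ^ l / x ^ l"
    using x by (simp add: field_simps flip: exp_of_nat_mult)
  have "real (P choose nat \<lfloor>u\<rfloor>) * (real (nat \<lfloor>u\<rfloor>) / real P) ^ (k 1 * l)
      \<le> exp (real (k 1 * l)) * (u / real P) powr (\<delta> * real (k 1 * l))"
    by (rule union_bound_le_powr[OF pos(1) u0 u1 u3])
  also have "\<dots> = (exp K * (u / real P) powr (\<delta> * K)) ^ l"
  proof -
    have "exp (real (k 1 * l)) = exp K ^ l" by (simp add: K_def mult.commute flip: exp_of_nat_mult)
    moreover have "(u / real P) powr (\<delta> * real (k 1 * l)) = ((u / real P) powr (\<delta> * K)) ^ l"
      using u0 P by (simp add: K_def powr_powr mult_ac flip: powr_realpow)
    ultimately show ?thesis by (simp add: power_mult_distrib)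
  qed
  also have "\<dots> \<le> (x * exp (- K)) ^ l"
    using overlap_cost_le[OF pos(1,3) x size[folded K_def] _ u2 u4] u0 P by (intro power_mono) auto
  finally have "real (n choose l) * (real (P choose nat \<lfloor>u\<rfloor>) * (real (nat \<lfloor>u\<rfloor>) / real P) ^ (k 1 * l))
      \<le> exp 1 ^ l / x ^ l * (x * exp (- K)) ^ l"
    using choose x by (intro mult_mono) auto
  also have "\<dots> = exp (1 - K) ^ l"
    using x by (simp add: power_mult_distrib exp_diff exp_minus field_simps)
  finally show ?thesis by (simp add: K_def)
qed

text \<open>
  The second part of the cut bound, in three ranges of the block size. Up to \<open>l0\<close>, of order
  \<open>n / log n\<close>, the Laplace transform is in its linear regime; avoidance then contributes
  \<open>n powr (- (1 - \<delta>)\<^sup>3 c' l)\<close>, to be weighed against the \<open>n\<^bsup>l\<^esup>\<close> choices. Between \<open>l0\<close> and \<open>\<beta> n\<close>, monotonicity of the Laplace transform preserves the gain at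
  \<open>l0\<close>, which is \<open>exp (- c0)\<close> for each vertex outside the block with a constant \<open>c0\<close>, and \<open>\<beta>\<close> is so
  small that the entropy of choosing the block is only half as large. Beyond \<open>\<beta> n\<close>, the smallest ring
  size alone makes each factor at most \<open>e\<^bsup>-4\<^esup>\<close>, against at most \<open>2\<^bsup>n\<^esup>\<close> choices.
\<close>

lemma separation_term_le:
  assumes l: "1 \<le> l" "2 * l \<le> n" and n: "2 \<le> n"
    and \<delta>: "0 < \<delta>" "\<delta> < 1" and \<beta>: "0 < \<beta>" "\<beta> \<le> 1" and c: "0 < c'" "0 < C" and \<eta>: "0 < \<eta>"
    and mean: "c' * ln (real n) / real n \<le> real (k 1) * mean_size / real P"
    and large: "real (k 1) * real (k r) / real P \<le> C * ln (real n) / real n"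
    and dense: "4 \<le> (1 - \<delta>) * \<beta> * (real n * (real (k 1))\<^sup>2 / real P)"
    and size: "\<delta> \<le> \<eta> * real (k 1)" "4 \<le> \<eta> * real (k 1)"
    and log: "1 \<le> C * ln (real n)"
    and sqrt_\<beta>: "2 * sqrt \<beta> = (1 - \<delta>)\<^sup>2 * \<delta> * c' / C / 4"
    and u: "u = min ((1 - \<delta>) * (real l * real (k 1))) (\<eta> * real P)"
  shows "real (n choose l) * laplace (u / real P) ^ (n - l)
       \<le> (real n powr (1 - (1 - \<delta>) ^ 3 * c')) ^ l
         + exp (- (min 1 ((1 - \<delta>)\<^sup>2 * \<delta> * c' / C / 4) * real n))"
proof -
  define K where "K = real (k 1)"
  define c0 where "c0 = (1 - \<delta>)\<^sup>2 * \<delta> * c' / C"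
  define l0 where "l0 = \<delta> * real n / (C * ln (real n))"
  define t where "t = u / real P"
  have n0: "0 < real n" using n by simp
  have ln0: "0 < ln (real n)" using n by simp
  have K: "0 < K" "K \<le> real (k r)" using size_pos size_min[of r] r_pos by (auto simp: K_def)
  have P: "0 < real P" using pool_pos by simp
  have half: "real n / 2 \<le> real (n - l)" using l by (simp add: of_nat_diff)
  have l0: "0 < l0" "l0 * (C * ln (real n) / real n) = \<delta>"
    using n0 ln0 c \<delta> by (auto simp: l0_def)
  have l0n: "l0 \<le> \<delta> * real n"
    using divide_left_mono[OF log, of "\<delta> * real n"] \<delta> n0 log by (simp add: l0_def)
  have c0: "0 < c0" using \<delta> c by (simp add: c0_def)
  \<comment> \<open>For block sizes up to \<open>l0\<close>, the argument of the Laplace transform stays in the linear regime.\<close>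
  have below: "s * (K / real P) * real (k r) \<le> \<delta>" if "s \<le> l0" "0 \<le> s" for s
  proof -
    have "s * (K / real P) * real (k r) = s * (real (k 1) * real (k r) / real P)"
      by (simp add: K_def)
    also have "\<dots> \<le> l0 * (C * ln (real n) / real n)"
      using large that c ln0 n0 by (intro mult_mono) auto
    finally show ?thesis using l0(2) by simp
  qed
  \<comment> \<open>In particular the cap \<open>\<eta> P\<close> on \<open>u\<close> is not reached up to \<open>l0\<close>.\<close>
  have \<eta>_ge: "(1 - \<delta>) * s * (K / real P) \<le> \<eta>" if "s \<le> l0" "0 \<le> s" for s
  proof -
    have "s * (K / real P) * K \<le> s * (K / real P) * real (k r)"
      using K that P by (intro mult_left_mono) auto
    also have "\<dots> \<le> \<delta>" by (rule below[OF that])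
    also have "\<dots> \<le> \<eta> * K" using size by (simp add: K_def)
    finally have "s * (K / real P) \<le> \<eta>" using K(1) by (rule mult_right_le_imp_le)
    moreover have "(1 - \<delta>) * (s * (K / real P)) \<le> 1 * (s * (K / real P))"
      using \<delta> that K P by (intro mult_right_mono) auto
    ultimately show ?thesis by (simp add: mult.assoc)
  qed
  have laplace_le: "laplace ((1 - \<delta>) * s * (K / real P)) \<le> exp (- ((1 - \<delta>)\<^sup>2 * s * (c' * ln (real n) / real n)))"
    if s: "s \<le> l0" "0 \<le> s" for s
  proof -
    have "(1 - \<delta>) * (s * (K / real P) * real (k r)) \<le> 1 * \<delta>"
      using below[OF s] \<delta> s K P by (intro mult_mono) auto
    hence "laplace ((1 - \<delta>) * s * (K / real P))
        \<le> exp (- ((1 - \<delta>) * ((1 - \<delta>) * s * (K / real P)) * mean_size))"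
      using \<delta> s K P by (intro laplace_le_mean_size) (auto simp: mult_ac)
    also have "(1 - \<delta>) * ((1 - \<delta>) * s * (K / real P)) * mean_size
        = (1 - \<delta>)\<^sup>2 * s * (real (k 1) * mean_size / real P)"
      by (simp add: power2_eq_square K_def)
    also have "exp (- ((1 - \<delta>)\<^sup>2 * s * (real (k 1) * mean_size / real P)))
        \<le> exp (- ((1 - \<delta>)\<^sup>2 * s * (c' * ln (real n) / real n)))"
      unfolding exp_le_cancel_iff using mean s by (intro le_imp_neg_le mult_left_mono) auto
    finally show ?thesis .
  qed
  have t_min: "t = min ((1 - \<delta>) * real l * (K / real P)) \<eta>"
    using P by (simp add: t_def u K_def min_divide_distrib_right)
  consider "real l \<le> l0" | "l0 < real l" "real l \<le> \<beta> * real n" | "\<beta> * real n < real l" by linarith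
  thus ?thesis
  proof cases
    case 1
    have t: "t = (1 - \<delta>) * real l * (K / real P)"
      using \<eta>_ge[OF 1] by (simp add: t_min)
    have "laplace t ^ (n - l) \<le> exp (- ((1 - \<delta>)\<^sup>2 * real l * (c' * ln (real n) / real n))) ^ (n - l)"
      unfolding t using laplace_le[OF 1] laplace_nonneg by (intro power_mono) auto
    also have "\<dots> = exp (- (real (n - l) / real n * ((1 - \<delta>)\<^sup>2 * real l * c' * ln (real n))))"
      unfolding exp_of_nat_mult[symmetric] by (simp add: mult_ac)
    also have "\<dots> \<le> exp (- ((1 - \<delta>) * ((1 - \<delta>)\<^sup>2 * real l * c' * ln (real n))))"
    proof -
      have "1 - \<delta> \<le> real (n - l) / real n"
        using 1 l0n n0 l by (simp add: of_nat_diff field_simps)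
      thus ?thesis unfolding exp_le_cancel_iff using c ln0 by (intro le_imp_neg_le mult_right_mono) auto
    qed
    also have "\<dots> = exp (- ((1 - \<delta>) ^ 3 * c' * ln (real n))) ^ l"
      unfolding exp_of_nat_mult[symmetric] by (simp add: power2_eq_square power3_eq_cube mult_ac)
    finally have lap: "laplace t ^ (n - l) \<le> exp (- ((1 - \<delta>) ^ 3 * c' * ln (real n))) ^ l" .
    have "real (n choose l) \<le> real (n ^ l)"
      using l by (intro of_nat_mono binomial_le_pow) auto
    hence "real (n choose l) * laplace t ^ (n - l)
        \<le> real n ^ l * exp (- ((1 - \<delta>) ^ 3 * c' * ln (real n))) ^ l"
      using lap laplace_nonneg by (intro mult_mono) auto
    also have "\<dots> = (real n powr (1 - (1 - \<delta>) ^ 3 * c')) ^ l"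
      using n0 by (simp add: powr_def left_diff_distrib exp_diff exp_minus divide_inverse
          flip: power_mult_distrib)
    finally show ?thesis by (simp add: t_def add_increasing2)
  next
    case 2
    have "(1 - \<delta>) * l0 * (K / real P) \<le> t"
    proof -
      have "(1 - \<delta>) * l0 * (K / real P) \<le> (1 - \<delta>) * real l * (K / real P)"
        using 2 \<delta> K P by (intro mult_right_mono mult_left_mono) auto
      thus ?thesis using \<eta>_ge[of l0] l0 by (simp add: t_min)
    qed
    hence "laplace t \<le> laplace ((1 - \<delta>) * l0 * (K / real P))" by (rule laplace_antimono)
    also have "\<dots> \<le> exp (- ((1 - \<delta>)\<^sup>2 * l0 * (c' * ln (real n) / real n)))"
      using l0 by (intro laplace_le) auto
    also have "(1 - \<delta>)\<^sup>2 * l0 * (c' * ln (real n) / real n) = c0"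
      using ln0 n0 c by (simp add: c0_def l0_def)
    finally have "laplace t ^ (n - l) \<le> exp (- c0) ^ (n - l)"
      using laplace_nonneg by (intro power_mono) auto
    also have "\<dots> \<le> exp (- (c0 * (real n / 2)))"
      unfolding exp_of_nat_mult[symmetric] using mult_left_mono[OF half, of c0] c0
      by (simp add: mult.commute)
    finally have "real (n choose l) * laplace t ^ (n - l)
        \<le> exp (2 * sqrt \<beta> * real n) * exp (- (c0 * (real n / 2)))"
      using choose_le_exp_sqrt[OF l(1) 2(2) \<beta>(2)] laplace_nonneg by (intro mult_mono) auto
    also have "\<dots> = exp (- (c0 / 4 * real n))"
    proof -
      have "2 * sqrt \<beta> = c0 / 4" using sqrt_\<beta> by (simp add: c0_def)
      thus ?thesis by (simp add: field_simps flip: exp_add)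
    qed
    also have "\<dots> \<le> exp (- (min 1 (c0 / 4) * real n))"
      unfolding exp_le_cancel_iff by (intro le_imp_neg_le mult_right_mono) auto
    finally show ?thesis by (simp add: t_def c0_def add_increasing)
  next
    case 3
    have t: "4 \<le> t * K"
    proof -
      have "(1 - \<delta>) * \<beta> * (real n * K\<^sup>2 / real P) \<le> (1 - \<delta>) * real l * (K / real P) * K"
      proof -
        have "(1 - \<delta>) * (K / real P) * K * (\<beta> * real n) \<le> (1 - \<delta>) * (K / real P) * K * real l"
          using 3 \<delta> K P by (intro mult_left_mono) auto
        thus ?thesis by (simp add: power2_eq_square mult_ac)
      qed
      hence "4 \<le> (1 - \<delta>) * real l * (K / real P) * K" using dense by (simp add: K_def)
      thus ?thesis using size by (simp add: t_min K_def min_def)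
    qed
    have t0: "0 \<le> t" using t K by (smt (verit) mult_nonpos_nonneg)
    have "laplace t ^ (n - l) \<le> exp (- (t * K)) ^ (n - l)"
      using laplace_le_smallest[OF t0] laplace_nonneg by (intro power_mono) (auto simp: K_def)
    also have "\<dots> \<le> exp (- 4) ^ (n - l)" using t by (intro power_mono) auto
    also have "\<dots> \<le> exp (- (2 * real n))" unfolding exp_of_nat_mult[symmetric] using half by simp
    finally have "laplace t ^ (n - l) \<le> exp (- (2 * real n))" .
    moreover have "real (n choose l) \<le> exp (real n)"
    proof -
      have "real (n choose l) \<le> 2 ^ n" using binomial_le_pow2[of n l] by (simp flip: of_nat_le_iff)
      also have "\<dots> \<le> exp 1 ^ n" using exp_ge_add_one_self[of "1::real"] by (intro power_mono) auto
      finally show ?thesis by (simp flip: exp_of_nat_mult)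
    qed
    ultimately have "real (n choose l) * laplace t ^ (n - l) \<le> exp (real n) * exp (- (2 * real n))"
      using laplace_nonneg by (intro mult_mono) auto
    also have "\<dots> = exp (- (1 * real n))" by (simp flip: exp_add)
    also have "\<dots> \<le> exp (- (min 1 (c0 / 4) * real n))"
      unfolding exp_le_cancel_iff by (intro le_imp_neg_le mult_right_mono) auto
    finally show ?thesis by (simp add: t_def c0_def add_increasing)
  qed
qed

text \<open>
  All block sizes together. The hypotheses that involve \<open>n\<close> hold eventually along a scaling above
  the threshold, and the three error terms tend to zero as \<open>n\<close> and the smallest ring size grow.
\<close>

lemma prob_connected_ge:
  assumes n: "2 \<le> n"
    and \<delta>: "0 < \<delta>" "\<delta> < 1" and \<sigma>: "0 < \<sigma>" and \<beta>: "0 < \<beta>" "\<beta> \<le> 1" and c: "0 < c'" "0 < C"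
    and \<eta>: "\<eta> = exp (- 3 / \<delta>)"
    and supercritical: "1 < (1 - \<delta>) ^ 3 * c'"
    and pool: "\<sigma> * real n \<le> real P"
    and mean: "c' * ln (real n) / real n \<le> real (k 1) * mean_size / real P"
    and large: "real (k 1) * real (k r) / real P \<le> C * ln (real n) / real n"
    and dense: "4 \<le> (1 - \<delta>) * \<beta> * (real n * (real (k 1))\<^sup>2 / real P)"
    and size: "6 / \<delta> \<le> real (k 1)" "real (k 1) * exp (- real (k 1) / 2) \<le> \<sigma>" "4 \<le> \<eta> * real (k 1)"
    and log: "1 \<le> C * ln (real n)"
    and sqrt_\<beta>: "2 * sqrt \<beta> = (1 - \<delta>)\<^sup>2 * \<delta> * c' / C / 4"
  defines "\<rho>1 \<equiv> exp (1 - real (k 1))" and "\<rho>2 \<equiv> real n powr (1 - (1 - \<delta>) ^ 3 * c')"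
    and "\<kappa> \<equiv> min 1 ((1 - \<delta>)\<^sup>2 * \<delta> * c' / C / 4)"
  shows "1 - measure_pmf.prob (random_key_graph n \<mu> k P) {G. Digraph_Component.connected (with_proj G)}
       \<le> \<rho>1 / (1 - \<rho>1) + \<rho>2 / (1 - \<rho>2) + real n * exp (- (\<kappa> * real n))"
proof -
  define u where "u l = min ((1 - \<delta>) * (real l * real (k 1))) (\<eta> * real P)" for l
  have \<eta>1: "0 < \<eta>" "\<eta> < 1" using \<delta> by (auto simp: \<eta>)
  have u: "0 \<le> u l" "u l \<le> real P" for l
    using \<delta> \<eta>1 mult_right_mono[of \<eta> 1 "real P"] by (auto simp: u_def min_le_iff_disj)
  define b where "b l = real (P choose nat \<lfloor>u l\<rfloor>) * (real (nat \<lfloor>u l\<rfloor>) / real P) ^ (k 1 * l)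
      + laplace (u l / real P) ^ (n - l)" for l
  have "1 - measure_pmf.prob (random_key_graph n \<mu> k P) {G. Digraph_Component.connected (with_proj G)}
      \<le> (\<Sum>l=1..n div 2. real (n choose l) * b l)"
  proof (rule prob_not_connected_le)
    fix S assume S: "S \<subseteq> {1..n}"
    hence "card ({1..n} - S) = n - card S" using finite_subset by (subst card_Diff_subset) auto
    thus "measure_pmf.prob (Pi_pmf {1..n} {} (\<lambda>_. ring)) {\<Sigma>. \<forall>x\<in>S. \<forall>y\<in>{1..n} - S. \<Sigma> x \<inter> \<Sigma> y = {}}
        \<le> b (card S)"
      using prob_cut_le[OF _ S u] by (simp add: b_def)
  qed (use n in simp)
  also have "\<dots> \<le> (\<Sum>l=1..n div 2. \<rho>1 ^ l + \<rho>2 ^ l + exp (- (\<kappa> * real n)))"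
  proof (rule sum_mono)
    fix l assume "l \<in> {1..n div 2}"
    hence l: "1 \<le> l" "2 * l \<le> n" "l \<le> n" by auto
    have "\<delta> \<le> \<eta> * real (k 1)" using size(3) \<delta> by simp
    note separation_term_le[OF l(1,2) n \<delta> \<beta> c \<eta>1(1) mean large dense this size(3) log sqrt_\<beta> u_def]
    moreover note overlap_term_le[OF l(1,3) \<delta> \<sigma> pool size(1,2) u_def[unfolded \<eta>], folded \<eta>]
    ultimately show "real (n choose l) * b l \<le> \<rho>1 ^ l + \<rho>2 ^ l + exp (- (\<kappa> * real n))"
      by (simp add: b_def \<rho>1_def \<rho>2_def \<kappa>_def distrib_left)
  qed
  also have "\<dots> = (\<Sum>l=1..n div 2. \<rho>1 ^ l) + (\<Sum>l=1..n div 2. \<rho>2 ^ l) + real (n div 2) * exp (- (\<kappa> * real n))"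
    by (simp add: sum.distrib)
  also have "\<dots> \<le> \<rho>1 / (1 - \<rho>1) + \<rho>2 / (1 - \<rho>2) + real n * exp (- (\<kappa> * real n))"
  proof (intro add_mono sum_power_le_geometric mult_right_mono)
    have "6 < 6 / \<delta>" using \<delta> by (simp add: field_simps)
    thus "\<rho>1 < 1" using size(1) by (simp add: \<rho>1_def)
    show "\<rho>2 < 1" unfolding \<rho>2_def using supercritical n by (intro powr_less_one) auto
  qed (auto simp: \<rho>1_def \<rho>2_def)
  finally show ?thesis .
qed

end

section \<open>Asymptotics\<close>

lemma scaling_mono:
  assumes "scaling r K P" "2 \<le> n" "i \<in> {1..r}" "j \<in> {1..r}" "i \<le> j"
  shows "K i n \<le> K j n"
  using assms(5,4)
proof (induction rule: dec_induct)
  case (step m)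
  hence "m \<in> {1..<r}" using assms(3) by auto
  hence "K m n \<le> K (Suc m) n" using assms(1,2) by (auto simp: scaling_def)
  thus ?case using step assms(3) by auto
qed simp

lemma key_rings_scaling:
  assumes "1 \<le> r" "set_pmf \<mu> \<subseteq> {1..r}" "\<forall>i\<in>{1..r}. pmf \<mu> i > 0" "scaling r K P" "2 \<le> n"
  shows "key_rings r \<mu> (\<lambda>i. K i n) (P n)"
proof
  show "1 \<le> K 1 n" "K r n < P n" using assms(4,5) by (auto simp: scaling_def)
  fix i assume "i \<in> {1..r}"
  thus "K 1 n \<le> K i n" "K i n \<le> K r n"
    using assms(1) by (auto intro!: scaling_mono[OF assms(4,5)])
qed (use assms in auto)

lemma (in key_rings) avoid_eq_mean_edge_prob:
  assumes "\<And>i. K i n = k i" "Q n = P"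
  shows "mean_edge_prob r \<mu> K Q 1 n = 1 - avoid (k 1)"
  using sum_class
  by (simp add: assms mean_edge_prob_def edge_prob_def avoid_def left_diff_distrib right_diff_distrib sum_subtractf
      mult.commute)

lemma asymp_equiv_imp_between:
  fixes f g :: "nat \<Rightarrow> real"
  assumes eq: "f \<sim>[at_top] (\<lambda>n. c * g n)" and c: "0 < c" "a < c" "c < b"
    and pos: "eventually (\<lambda>n. 0 < g n) at_top"
  shows "eventually (\<lambda>n. a * g n \<le> f n \<and> f n \<le> b * g n) at_top"
proof -
  have "eventually (\<lambda>n. f n \<noteq> 0 \<or> c * g n \<noteq> 0) at_top"
    using pos by eventually_elim (use c in auto)
  from asymp_equivD_strong[OF eq this] have lim: "(\<lambda>n. f n / (c * g n)) \<longlonglongrightarrow> 1" .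
  have "eventually (\<lambda>n. a / c < f n / (c * g n)) at_top"
    using c by (intro order_tendstoD(1)[OF lim]) (simp add: field_simps)
  moreover have "eventually (\<lambda>n. f n / (c * g n) < b / c) at_top"
    using c by (intro order_tendstoD(2)[OF lim]) (simp add: field_simps)
  ultimately show ?thesis using pos
    by eventually_elim (use c in \<open>auto simp: field_simps\<close>)
qed

text \<open>
  Here \<open>e\<close> bounds the mean edge probability. The first term vanishes because the expected number
  \<open>n (1 - e)\<^bsup>n\<^esup>\<close> of isolated vertices grows like \<open>n\<^bsup>1-b\<^esup>\<close>, the second tends to \<open>1\<close> because
  \<open>n e\<^sup>2\<close> tends to \<open>0\<close>.
\<close>

lemma subcritical_bound_tendsto_0:
  fixes b m H :: real
  assumes b: "0 < b" "b < 1" and m: "0 < m"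
  defines "e \<equiv> (\<lambda>n. b * ln (real n) / real n)"
  shows "(\<lambda>n. 1 / (real n * m * (1 - e n) ^ n)
     + exp (real n * (H * (e n)\<^sup>2 / (1 - e n)\<^sup>2)) / (1 - e n)\<^sup>2 - 1) \<longlonglongrightarrow> 0"
proof -
  have e0: "e \<longlonglongrightarrow> 0" unfolding e_def by real_asymp
  have "(\<lambda>n. real n * (e n)\<^sup>2) \<longlonglongrightarrow> 0" unfolding e_def using b by real_asymp
  hence "(\<lambda>n. exp (H * (real n * (e n)\<^sup>2) / (1 - e n)\<^sup>2) / (1 - e n)\<^sup>2) \<longlonglongrightarrow> exp (H * 0 / (1 - 0)\<^sup>2) / (1 - 0)\<^sup>2"
    by (intro tendsto_intros e0) auto
  hence 1: "(\<lambda>n. exp (real n * (H * (e n)\<^sup>2 / (1 - e n)\<^sup>2)) / (1 - e n)\<^sup>2) \<longlonglongrightarrow> 1"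
    by (simp add: mult_ac)
  have powr: "filterlim (\<lambda>n. real n * m * (1 - e n) powr real n) at_top at_top"
    unfolding e_def using b m by real_asymp
  have "eventually (\<lambda>n. e n < 1) at_top" by (rule order_tendstoD(2)[OF e0]) simp
  hence "eventually (\<lambda>n. real n * m * (1 - e n) powr real n = real n * m * (1 - e n) ^ n) at_top"
    by eventually_elim (simp add: powr_realpow)
  from powr[unfolded filterlim_cong[OF refl refl this]]
  have "filterlim (\<lambda>n. real n * m * (1 - e n) ^ n) at_top at_top" .
  hence "(\<lambda>n. 1 / (real n * m * (1 - e n) ^ n)) \<longlonglongrightarrow> 0"
    by (intro tendsto_divide_0[OF tendsto_const] filterlim_at_top_imp_at_infinity)
  from tendsto_diff[OF tendsto_add[OF this 1] tendsto_const[of 1]] show ?thesis by simp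
qed

lemma prob_connected_tendsto_0:
  fixes r :: nat and \<mu> :: "nat pmf" and K :: "nat \<Rightarrow> nat \<Rightarrow> nat" and P :: "nat \<Rightarrow> nat"
  assumes model: "1 \<le> r" "set_pmf \<mu> \<subseteq> {1..r}" "\<forall>i\<in>{1..r}. pmf \<mu> i > 0" "scaling r K P"
    and c: "0 < c" "c < 1"
    and mean: "mean_edge_prob r \<mu> K P 1 \<sim>[at_top] (\<lambda>n. c * ln (real n) / real n)"
  shows "(\<lambda>n. measure_pmf.prob (random_key_graph n \<mu> (\<lambda>i. K i n) (P n))
            {G. Digraph_Component.connected (with_proj G)}) \<longlonglongrightarrow> 0"
    (is "?p \<longlonglongrightarrow> 0")
proof -
  define b where "b = (1 + c) / 2"
  have b: "0 < b" "b < 1" "c < b" using c by (auto simp: b_def)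
  define e where "e n = b * ln (real n) / real n" for n
  define H where "H = (\<Sum>j=1..r. 1 / pmf \<mu> j)"
  have \<mu>1: "0 < pmf \<mu> 1" using model by auto
  have H: "0 \<le> H" using model(3) unfolding H_def by (intro sum_nonneg) (auto intro: less_imp_le)
  have "mean_edge_prob r \<mu> K P 1 \<sim>[at_top] (\<lambda>n. c * (ln (real n) / real n))" using mean by simp
  moreover have "eventually (\<lambda>n. 0 < ln (real n) / real n) at_top" by real_asymp
  ultimately have ev1: "eventually (\<lambda>n. 0 * (ln (real n) / real n) \<le> mean_edge_prob r \<mu> K P 1 n
      \<and> mean_edge_prob r \<mu> K P 1 n \<le> b * (ln (real n) / real n)) at_top"
    using c b by (intro asymp_equiv_imp_between) auto
  have "e \<longlonglongrightarrow> 0" unfolding e_def by real_asymp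
  hence ev2: "eventually (\<lambda>n. e n < 1) at_top" by (rule order_tendstoD) simp
  have bound: "eventually (\<lambda>n. ?p n \<le> 1 / (real n * pmf \<mu> 1 * (1 - e n) ^ n)
     + exp (real n * (H * (e n)\<^sup>2 / (1 - e n)\<^sup>2)) / (1 - e n)\<^sup>2 - 1) at_top"
    using ev1 ev2 eventually_ge_at_top[of 2]
  proof eventually_elim
    case (elim n)
    interpret key_rings r \<mu> "\<lambda>i. K i n" "P n"
      using key_rings_scaling[OF model \<open>2 \<le> n\<close>] .
    define q where "q = avoid (K 1 n)"
    have q: "1 - q \<le> e n" "q \<le> 1" "1 - e n \<le> q" "0 < 1 - e n"
      using elim avoid_eq_mean_edge_prob[of K n P, OF refl refl] avoid_le_1 by (auto simp: q_def e_def)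
    have "?p n \<le> 1 / (real n * pmf \<mu> 1 * q ^ (n - 1)) + exp (real n * (H * (1 - q)\<^sup>2 / q\<^sup>2)) / q\<^sup>2 - 1"
      using prob_connected_le[OF \<open>2 \<le> n\<close>] q by (simp add: q_def H_def)
    also have "1 / (real n * pmf \<mu> 1 * q ^ (n - 1)) \<le> 1 / (real n * pmf \<mu> 1 * (1 - e n) ^ n)"
    proof -
      have "(1 - e n) ^ n \<le> q ^ n" using q by (intro power_mono) auto
      also have "\<dots> \<le> q ^ (n - 1)" using q by (intro power_decreasing) auto
      finally show ?thesis using \<mu>1 elim q
        by (intro divide_left_mono mult_left_mono mult_pos_pos zero_less_power) auto
    qed
    also have "exp (real n * (H * (1 - q)\<^sup>2 / q\<^sup>2)) / q\<^sup>2
        \<le> exp (real n * (H * (e n)\<^sup>2 / (1 - e n)\<^sup>2)) / (1 - e n)\<^sup>2"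
    proof -
      have "(1 - e n)\<^sup>2 \<le> q\<^sup>2" "(1 - q)\<^sup>2 \<le> (e n)\<^sup>2" using q by (auto intro!: power_mono)
      thus ?thesis using q H
        by (intro frac_le) (auto intro!: mult_left_mono frac_le)
    qed
    finally show ?case by simp
  qed
  have "(\<lambda>n. 1 / (real n * pmf \<mu> 1 * (1 - e n) ^ n)
     + exp (real n * (H * (e n)\<^sup>2 / (1 - e n)\<^sup>2)) / (1 - e n)\<^sup>2 - 1) \<longlonglongrightarrow> 0"
    using subcritical_bound_tendsto_0[OF b(1,2) \<mu>1] by (simp add: e_def)
  from tendsto_sandwich[OF _ bound tendsto_const this] show ?thesis by simp
qed

lemma prob_connected_tendsto_1:
  fixes r :: nat and \<mu> :: "nat pmf" and K :: "nat \<Rightarrow> nat \<Rightarrow> nat" and P :: "nat \<Rightarrow> nat"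
  assumes model: "1 \<le> r" "set_pmf \<mu> \<subseteq> {1..r}" "\<forall>i\<in>{1..r}. pmf \<mu> i > 0" "scaling r K P"
    and c: "1 < c"
    and mean: "mean_edge_prob r \<mu> K P 1 \<sim>[at_top] (\<lambda>n. c * ln (real n) / real n)"
    and pool: "(\<lambda>n. real (P n)) \<in> \<Omega>(\<lambda>n. real n)"
    and dense: "(\<lambda>n. (real (K 1 n))\<^sup>2 / real (P n)) \<in> \<omega>(\<lambda>n. 1 / real n)"
  shows "(\<lambda>n. measure_pmf.prob (random_key_graph n \<mu> (\<lambda>i. K i n) (P n))
            {G. Digraph_Component.connected (with_proj G)}) \<longlonglongrightarrow> 1"
    (is "?p \<longlonglongrightarrow> 1")
proof -
  let ?lam = "mean_edge_prob r \<mu> K P 1"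
  define c' where "c' = (1 + c) / 2"
  have c': "1 < c'" "c' < c" using c by (auto simp: c'_def)
  \<comment> \<open>Small enough that \<open>c' > 1\<close> survives the loss of three factors \<open>1 - \<delta>\<close>, by Bernoulli's inequality.\<close>
  define \<delta> where "\<delta> = (c' - 1) / (6 * c')"
  have \<delta>: "0 < \<delta>" "\<delta> < 1" using c' by (auto simp: \<delta>_def field_simps)
  have supercritical: "1 < (1 - \<delta>) ^ 3 * c'"
  proof -
    have "1 < (1 - 3 * \<delta>) * c'" using c' by (simp add: \<delta>_def field_simps)
    also have "\<dots> \<le> (1 - \<delta>) ^ 3 * c'"
      using Bernoulli_inequality[of "- \<delta>" 3] \<delta> c' by (intro mult_right_mono) auto
    finally show ?thesis .
  qed
  have \<mu>r: "0 < pmf \<mu> r" "pmf \<mu> r \<le> 1" using model by (auto intro: pmf_le_1)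
  \<comment> \<open>The factor from \<open>largest_size_le_mean_edge\<close> times the eventual bound \<open>2 c ln n / n\<close> on the mean.\<close>
  define C where "C = 4 * c / pmf \<mu> r"
  have C: "4 * c \<le> C" "0 < C" using \<mu>r c by (auto simp: C_def field_simps)
  define X where "X = (1 - \<delta>)\<^sup>2 * \<delta> * c' / C"
  have X: "0 < X" "X \<le> 1"
  proof -
    show "0 < X" using \<delta> c' C by (simp add: X_def)
    have "(1 - \<delta>)\<^sup>2 * \<delta> * c' \<le> 1 * 1 * C"
      using \<delta> c' C c by (intro mult_mono) (auto intro: power_le_one)
    thus "X \<le> 1" using C by (simp add: X_def)
  qed
  \<comment> \<open>Chosen such that the entropy \<open>2 \<surd>\<beta>\<close> of a block is half of the gain \<open>X / 2\<close> from the other vertices.\<close>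
  define \<beta> where "\<beta> = (X / 8)\<^sup>2"
  have \<beta>: "0 < \<beta>" "\<beta> \<le> 1" using X by (auto simp: \<beta>_def intro!: power_le_one)
  have sqrt_\<beta>: "2 * sqrt \<beta> = (1 - \<delta>)\<^sup>2 * \<delta> * c' / C / 4"
    using X by (simp add: \<beta>_def flip: X_def)
  define \<eta> where "\<eta> = exp (- 3 / \<delta>)"
  obtain \<sigma> where \<sigma>: "0 < \<sigma>" and ev_pool: "eventually (\<lambda>n. \<sigma> * real n \<le> real (P n)) at_top"
    using landau_omega.bigE[OF pool] by auto
  have ev_dense: "eventually (\<lambda>n. W \<le> real n * (real (K 1 n))\<^sup>2 / real (P n)) at_top" if "0 < W" for W
    using landau_omega.smallD[OF dense that] eventually_gt_at_top[of 0]
    by eventually_elim (simp add: field_simps)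
  \<comment> \<open>\<open>K\<^sub>1\<^sup>2\<close> is large compared with \<open>P / n\<close>, and \<open>P / n\<close> is bounded below.\<close>
  have K_top: "filterlim (\<lambda>n. real (K 1 n)) at_top at_top"
    unfolding filterlim_at_top_gt[where c = 0]
  proof (intro allI impI)
    fix B :: real assume B: "0 < B"
    show "eventually (\<lambda>n. B \<le> real (K 1 n)) at_top"
      using ev_dense[of "B\<^sup>2 / \<sigma>"] ev_pool eventually_gt_at_top[of 0]
    proof (rule eventually_elim2 [OF _ eventually_conj])
      show "0 < B\<^sup>2 / \<sigma>" using B \<sigma> by simp
    next
      fix n assume n: "B\<^sup>2 / \<sigma> \<le> real n * (real (K 1 n))\<^sup>2 / real (P n)" "\<sigma> * real n \<le> real (P n) \<and> 0 < n"
      hence "0 < \<sigma> * real n" using \<sigma> by simp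
      hence "real n * (real (K 1 n))\<^sup>2 / real (P n) \<le> real n * (real (K 1 n))\<^sup>2 / (\<sigma> * real n)"
        using n by (intro divide_left_mono) auto
      also have "\<dots> = (real (K 1 n))\<^sup>2 / \<sigma>" using n by simp
      finally have "B\<^sup>2 / \<sigma> \<le> (real (K 1 n))\<^sup>2 / \<sigma>" using n by linarith
      hence "B\<^sup>2 \<le> (real (K 1 n))\<^sup>2" using \<sigma> by (simp add: divide_le_cancel)
      thus "B \<le> real (K 1 n)" by (rule power2_le_imp_le) simp
    qed
  qed
  have ev_K: "eventually (\<lambda>n. Q (real (K 1 n))) at_top" if "eventually Q at_top" for Q
    using filterlim_iff[THEN iffD1, OF K_top] that by blast
  have "((\<lambda>x::real. x * exp (- x / 2)) \<longlongrightarrow> 0) at_top" by real_asymp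
  hence "eventually (\<lambda>x::real. x * exp (- x / 2) < \<sigma>) at_top" using \<sigma> by (rule order_tendstoD)
  hence ev_size: "eventually (\<lambda>n. real (K 1 n) * exp (- real (K 1 n) / 2) < \<sigma>) at_top"
    by (rule ev_K)
  have "?lam \<sim>[at_top] (\<lambda>n. c * (ln (real n) / real n))" using mean by simp
  moreover have "eventually (\<lambda>n. 0 < ln (real n) / real n) at_top" by real_asymp
  ultimately have ev_mean: "eventually (\<lambda>n. c' * (ln (real n) / real n) \<le> ?lam n
      \<and> ?lam n \<le> 2 * c * (ln (real n) / real n)) at_top"
    using c c' by (intro asymp_equiv_imp_between) auto
  have "(\<lambda>n. 2 * c * (ln (real n) / real n)) \<longlonglongrightarrow> 0" by real_asymp
  hence ev_half: "eventually (\<lambda>n. 2 * c * (ln (real n) / real n) < pmf \<mu> r / 2) at_top"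
    by (rule order_tendstoD) (use \<mu>r in simp)
  have ev_log: "eventually (\<lambda>n. 1 \<le> C * ln (real n)) at_top"
    using C by real_asymp
  have \<eta>0: "0 < \<eta>" by (simp add: \<eta>_def)
  have W: "0 < 4 / ((1 - \<delta>) * \<beta>)" using \<delta> \<beta> by simp
  define bound where "bound n = exp (1 - real (K 1 n)) / (1 - exp (1 - real (K 1 n)))
      + real n powr (1 - (1 - \<delta>) ^ 3 * c') / (1 - real n powr (1 - (1 - \<delta>) ^ 3 * c'))
      + real n * exp (- (min 1 ((1 - \<delta>)\<^sup>2 * \<delta> * c' / C / 4) * real n))" for n
  have "eventually (\<lambda>n. 1 - ?p n \<le> bound n) at_top"
    using ev_pool ev_dense[OF W] ev_size ev_K[OF eventually_ge_at_top[of "6 / \<delta>"]]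
      ev_K[OF eventually_ge_at_top[of "4 / \<eta>"]] ev_mean ev_half ev_log eventually_ge_at_top[of 2]
  proof eventually_elim
    case (elim n)
    interpret key_rings r \<mu> "\<lambda>i. K i n" "P n"
      using key_rings_scaling[OF model \<open>2 \<le> n\<close>] .
    have lam: "?lam n = 1 - avoid (K 1 n)"
      using avoid_eq_mean_edge_prob[of K n P, OF refl refl] by simp
    have "c' * ln (real n) / real n \<le> real (K 1 n) * mean_size / real (P n)"
      using mean_edge_le_mean_size elim lam by simp
    moreover have "real (K 1 n) * real (K r n) / real (P n) \<le> C * ln (real n) / real n"
    proof -
      have "real (K 1 n) * real (K r n) / real (P n) \<le> 2 / pmf \<mu> r * ?lam n"
        unfolding lam by (rule largest_size_le_mean_edge) (use elim lam in linarith)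
      also have "\<dots> \<le> 2 / pmf \<mu> r * (2 * c * (ln (real n) / real n))"
        using elim \<mu>r by (intro mult_left_mono) auto
      finally show ?thesis by (simp add: C_def mult_ac)
    qed
    moreover have "4 \<le> (1 - \<delta>) * \<beta> * (real n * (real (K 1 n))\<^sup>2 / real (P n))"
    proof -
      have "4 = (1 - \<delta>) * \<beta> * (4 / ((1 - \<delta>) * \<beta>))" using \<delta> \<beta> by simp
      also have "\<dots> \<le> (1 - \<delta>) * \<beta> * (real n * (real (K 1 n))\<^sup>2 / real (P n))"
        using elim \<delta> \<beta> by (intro mult_left_mono) auto
      finally show ?thesis .
    qed
    moreover have "4 \<le> \<eta> * real (K 1 n)" using elim \<eta>0 by (simp add: field_simps)
    ultimately show ?case
      unfolding bound_def using elim c c' C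
      by (intro prob_connected_ge[OF \<open>2 \<le> n\<close> \<delta> \<sigma> \<beta> _ _ \<eta>_def supercritical _ _ _ _ _ _ _ _ sqrt_\<beta>]) auto
  qed
  hence lower: "eventually (\<lambda>n. 1 - bound n \<le> ?p n) at_top" by eventually_elim simp
  have "bound \<longlonglongrightarrow> 0"
  proof -
    have "((\<lambda>x::real. exp (1 - x) / (1 - exp (1 - x))) \<longlongrightarrow> 0) at_top" by real_asymp
    hence 1: "(\<lambda>n. exp (1 - real (K 1 n)) / (1 - exp (1 - real (K 1 n)))) \<longlonglongrightarrow> 0"
      using K_top by (rule filterlim_compose)
    define \<gamma> where "\<gamma> = (1 - \<delta>) ^ 3 * c' - 1"
    have "0 < \<gamma>" using supercritical by (simp add: \<gamma>_def)
    hence "(\<lambda>n. real n powr (- \<gamma>) / (1 - real n powr (- \<gamma>))) \<longlonglongrightarrow> 0" by real_asymp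
    moreover have "1 - (1 - \<delta>) ^ 3 * c' = - \<gamma>" by (simp add: \<gamma>_def)
    ultimately have 2: "(\<lambda>n. real n powr (1 - (1 - \<delta>) ^ 3 * c') / (1 - real n powr (1 - (1 - \<delta>) ^ 3 * c'))) \<longlonglongrightarrow> 0"
      by simp
    define \<kappa> where "\<kappa> = min 1 ((1 - \<delta>)\<^sup>2 * \<delta> * c' / C / 4)"
    have "0 < \<kappa>" using X by (simp add: \<kappa>_def flip: X_def)
    hence 3: "(\<lambda>n. real n * exp (- (\<kappa> * real n))) \<longlonglongrightarrow> 0" by real_asymp
    from tendsto_add[OF tendsto_add[OF 1 2] 3] show ?thesis by (simp add: bound_def[abs_def] \<kappa>_def)
  qed
  from tendsto_diff[OF tendsto_const[of 1] this] have "(\<lambda>n. 1 - bound n) \<longlonglongrightarrow> 1" by simp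
  from tendsto_sandwich[OF lower _ this tendsto_const] show ?thesis by simp
qed

theorem theorem3p2:
  fixes r :: nat and \<mu> :: "nat pmf" and K :: "nat \<Rightarrow> nat \<Rightarrow> nat" and P :: "nat \<Rightarrow> nat"
    and c :: real
  assumes "r \<ge> 1"
    and "set_pmf \<mu> \<subseteq> {1..r}"
    and "\<forall>i\<in>{1..r}. pmf \<mu> i > 0"
    and "scaling r K P"
    and "c > 0"
    and "mean_edge_prob r \<mu> K P 1 \<sim>[at_top] (\<lambda>n. c * ln (real n) / real n)"
    and "(\<lambda>n. real (P n)) \<in> \<Omega>(\<lambda>n. real n)"
    and "(\<lambda>n. (real (K 1 n))\<^sup>2 / real (P n)) \<in> \<omega>(\<lambda>n. 1 / real n)"
  shows "(c < 1 \<longrightarrow>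
           (\<lambda>n. measure_pmf.prob (random_key_graph n \<mu> (\<lambda>i. K i n) (P n))
                  {G. Digraph_Component.connected (with_proj G)}) \<longlonglongrightarrow> 0) \<and>
         (c > 1 \<longrightarrow>
           (\<lambda>n. measure_pmf.prob (random_key_graph n \<mu> (\<lambda>i. K i n) (P n))
                  {G. Digraph_Component.connected (with_proj G)}) \<longlonglongrightarrow> 1)"
proof (intro conjI impI)
  assume "c < 1"
  show "(\<lambda>n. measure_pmf.prob (random_key_graph n \<mu> (\<lambda>i. K i n) (P n))
                  {G. Digraph_Component.connected (with_proj G)}) \<longlonglongrightarrow> 0"
    by (rule prob_connected_tendsto_0[OF assms(1-5) \<open>c < 1\<close> assms(6)])
next
  assume "1 < c"
  show "(\<lambda>n. measure_pmf.prob (random_key_graph n \<mu> (\<lambda>i. K i n) (P n))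
                  {G. Digraph_Component.connected (with_proj G)}) \<longlonglongrightarrow> 1"
    by (rule prob_connected_tendsto_1[OF assms(1-4) \<open>1 < c\<close> assms(6-8)])
qed

end
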